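(* Let $(p_n)_{n\geq 0}$ be an increasing sequence of prime numbers such that $p_n\geq 5^{2(n+1)}$ for all $n\geq 0$, and let $G=\bigoplus_{n=0}^\infty \mathbb{Z}/p_n\mathbb{Z}$. Then there exists a measure-preserving action $T=(T_g)_{g\in G}$ of $G$ on a standard probability Borel space $(X,\mathcal{B},\mu)$ whose Koopman representation has simple spectrum and which does not have the AT property.
   Context: A measure-preserving action of a countable discrete Abelian group $G$ on a standard probability Borel space $(X,\mathcal{B},\mu)$ is a homomorphism $g\mapsto T_g$ into the group of measure-preserving automorphisms of $(X,\mathcal{B},\mu)$. Its Koopman representation is the unitary representation $g\mapsto U_{T_g}$ on $L^2(X,\mathcal{B},\mu)$, $U_{T_g}f=f\circ T_g$; it has simple spectrum if there is $f\in L^2(X,\mathcal{B},\mu)$ with $L^2(X,\mathcal{B},\mu)=\overline{\mathrm{span}}\{f\circ T_g: g\in G\}$. The action $T$ has the AT (approximate transitivity) property if for every $l\geq 2$, every family of nonnegative functions $f_1,\ldots,f_l\in L^1_+(X,\mathcal{B},\mu)$ and every $\varepsilon>0$ there exist a positive integer $s$, elements $g_1,\ldots,g_s\in G$, real numbers $\lambda_{j,k}>0$ ($1\le j\le l$, $1\le k\le s$) and $f\in L^1_+(X,\mathcal{B},\mu)$ such that $\|f_j-\sum_{k=1}^s\lambda_{j,k}\, f\circ T_{g_k}\|_1<\varepsilon$ for all $1\leq j\leq l$. *)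

theory Defs
  imports "HOL-Probability.Probability" "HOL-Computational_Algebra.Primes"
begin

definition Gset :: "(nat \<Rightarrow> nat) \<Rightarrow> (nat \<Rightarrow> int) set" where
  "Gset p = {g. finite {n. g n \<noteq> 0} \<and> (\<forall>n. 0 \<le> g n \<and> g n < int (p n))}"

definition Gadd :: "(nat \<Rightarrow> nat) \<Rightarrow> (nat \<Rightarrow> int) \<Rightarrow> (nat \<Rightarrow> int) \<Rightarrow> (nat \<Rightarrow> int)" where
  "Gadd p g h = (\<lambda>n. (g n + h n) mod int (p n))"

text \<open>Measure-preserving action: a homomorphism g \<mapsto> T g from the group (G, add, zero)
  into measure-preserving maps (these are automatically invertible, T g having inverse T (-g)).\<close>

definition measure_preserving_action ::
  "'a measure \<Rightarrow> 'g set \<Rightarrow> ('g \<Rightarrow> 'g \<Rightarrow> 'g) \<Rightarrow> 'g \<Rightarrow> ('g \<Rightarrow> 'a \<Rightarrow> 'a) \<Rightarrow> bool" where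
  "measure_preserving_action M G add zero T \<longleftrightarrow>
     (\<forall>g\<in>G. T g \<in> measurable M M \<and> distr M M (T g) = M) \<and>
     (\<forall>g\<in>G. \<forall>h\<in>G. \<forall>x\<in>space M. T (add g h) x = T g (T h x)) \<and>
     (\<forall>x\<in>space M. T zero x = x)"

definition koopman_simple_spectrum ::
  "'a measure \<Rightarrow> 'g set \<Rightarrow> ('g \<Rightarrow> 'a \<Rightarrow> 'a) \<Rightarrow> bool" where
  "koopman_simple_spectrum M G T \<longleftrightarrow>
     (\<exists>f :: 'a \<Rightarrow> complex. f \<in> borel_measurable M \<and> integrable M (\<lambda>x. (cmod (f x))\<^sup>2) \<and>
       (\<forall>h :: 'a \<Rightarrow> complex. h \<in> borel_measurable M \<and> integrable M (\<lambda>x. (cmod (h x))\<^sup>2) \<longrightarrow>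
         (\<forall>\<epsilon>>0. \<exists>S c. finite S \<and> S \<subseteq> G \<and>
            integrable M (\<lambda>x. (cmod (h x - (\<Sum>g\<in>S. c g * f (T g x))))\<^sup>2) \<and>
            (\<integral>x. (cmod (h x - (\<Sum>g\<in>S. c g * f (T g x))))\<^sup>2 \<partial>M) < \<epsilon>)))"

definition AT_property ::
  "'a measure \<Rightarrow> 'g set \<Rightarrow> ('g \<Rightarrow> 'a \<Rightarrow> 'a) \<Rightarrow> bool" where
  "AT_property M G T \<longleftrightarrow>
     (\<forall>l::nat. l \<ge> 2 \<longrightarrow> (\<forall>F :: nat \<Rightarrow> 'a \<Rightarrow> real.
        (\<forall>j<l. integrable M (F j) \<and> (AE x in M. F j x \<ge> 0)) \<longrightarrow>
        (\<forall>\<epsilon>>0. \<exists>s::nat. s > 0 \<and> (\<exists>gs :: nat \<Rightarrow> 'g. \<exists>lam :: nat \<Rightarrow> nat \<Rightarrow> real. \<exists>f :: 'a \<Rightarrow> real.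
           (\<forall>k<s. gs k \<in> G) \<and> (\<forall>j<l. \<forall>k<s. lam j k > 0) \<and>
           integrable M f \<and> (AE x in M. f x \<ge> 0) \<and>
           (\<forall>j<l. integrable M (\<lambda>x. \<bar>F j x - (\<Sum>k<s. lam j k * f (T (gs k) x))\<bar>) \<and>
                  (\<integral>x. \<bar>F j x - (\<Sum>k<s. lam j k * f (T (gs k) x))\<bar> \<partial>M) < \<epsilon>)))))"

end

theory Submission
  imports Defs "HOL-Number_Theory.Number_Theory"
begin

text \<open>
  Let \<open>G\<close> act on the product of the groups \<open>\<int>/p\<^sub>n\<close> by translations, and extend this action to two
  sheets by the cocycle \<open>\<phi>\<^sub>g(x) = \<Prod>\<^sub>n c\<^sub>n(x\<^sub>n + g\<^sub>n) c\<^sub>n(x\<^sub>n)\<close>, where \<open>c\<^sub>n\<close> is the Legendre symbol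
  modulo \<open>p\<^sub>n\<close>, set to \<open>1\<close> at \<open>0\<close>. Mixed radix expansions realise the space as \<open>[0,2)\<close> with normalised
  Lebesgue measure, the integer part being the sheet. Let \<open>s = \<plusminus>1\<close> be the sign of the sheet. The
  correlations of the Legendre symbol give the flatness estimate
  \<open>\<parallel>\<Sum>\<^sub>g m\<^sub>g s \<circ> T\<^sub>g\<parallel>\<^sub>2\<^sup>2 \<le> K \<Sum>\<^sub>g m\<^sub>g\<^sup>2\<close> with \<open>K = \<Prod>\<^sub>n (1 + 1/sqrt p\<^sub>n)\<^sup>2 \<le> exp (1/2) < 2\<close>, the only
  place where the growth of \<open>p\<close> matters.

  No approximate transitivity: suppose \<open>1 + s \<approx> \<Sum>\<^sub>g l\<^sub>g f \<circ> T\<^sub>g\<close> and \<open>1 - s \<approx> \<Sum>\<^sub>g l'\<^sub>g f \<circ> T\<^sub>g\<close> with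
  \<open>\<integral>f = 1\<close>. Testing against \<open>s\<close> shows that \<open>f\<close> lives essentially on the set \<open>B\<close> where
  \<open>\<Sum>\<^sub>g (l\<^sub>g - l'\<^sub>g) s \<circ> T\<^sub>-\<^sub>g \<approx> 2\<close>. Covering the space by translates of \<open>f\<close> forces almost all
  coefficients to be at most about \<open>2\<mu>(B)\<close>, so by flatness and \<open>(a - b)\<^sup>2 \<le> a\<^sup>2 + b\<^sup>2\<close> for
  \<open>a, b \<ge> 0\<close> the squared norm of this sum is at most about \<open>4K\<mu>(B)\<close>; but it is at least about \<open>8\<mu>(B)\<close>,
  because \<open>B\<close> and its mirror image on the other sheet both contribute.

  Simple spectrum: \<open>s + \<Sum>\<^sub>k 2\<^sup>-\<^sup>k 1\<^bsub>[x\<^sub>0 = \<dots> = x\<^sub>k\<^sub>-\<^sub>1 = 0]\<^esub>\<close> is cyclic. Averaging it over the digits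
  \<open>M, \<dots>, N - 1\<close> kills \<open>s\<close> as \<open>N \<rightarrow> \<infinity>\<close> by flatness and isolates the cylinder functions one after the
  other, hence also \<open>s\<close>; and the translates of \<open>c\<^sub>n\<close> span all functions on \<open>\<int>/p\<^sub>n\<close>.
\<close>

section \<open>Correlations of the Legendre symbol\<close>

lemma sum_mod_shift:
  fixes q :: int and u :: "int \<Rightarrow> 'a::comm_monoid_add"
  assumes "q > 0"
  shows "(\<Sum>x\<in>{0..<q}. u ((x + a) mod q)) = (\<Sum>x\<in>{0..<q}. u x)"
proof -
  have inv: "((x + a) mod q - a) mod q = x" "((x - a) mod q + a) mod q = x" if "x \<in> {0..<q}" for x
    using that by (simp_all add: mod_simps)
  show ?thesis
    by (rule sum.reindex_bij_witness[of _ "\<lambda>x. (x - a) mod q" "\<lambda>x. (x + a) mod q"])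
       (use assms inv in auto)
qed

lemma sum_mod_scale:
  fixes q :: int and u :: "int \<Rightarrow> 'a::comm_monoid_add"
  assumes "q > 0" "coprime t q"
  shows "(\<Sum>x\<in>{0..<q}. u ((t * x) mod q)) = (\<Sum>x\<in>{0..<q}. u x)"
proof -
  obtain r where r: "[t * r = 1] (mod q)"
    using assms(2) cong_solve_coprime_int by blast
  have inv: "(r * ((t * x) mod q)) mod q = x" "(t * ((r * x) mod q)) mod q = x"
    if "x \<in> {0..<q}" for x
  proof -
    have "[(t * r) * x = 1 * x] (mod q)"
      using r cong_scalar_right by blast
    then have "(t * r * x) mod q = x"
      using that by (simp add: cong_def)
    then show "(r * ((t * x) mod q)) mod q = x" "(t * ((r * x) mod q)) mod q = x"
      by (simp_all add: mod_simps mult_ac)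
  qed
  show ?thesis
    by (rule sum.reindex_bij_witness[of _ "\<lambda>x. (r * x) mod q" "\<lambda>x. (t * x) mod q"])
       (use assms inv in auto)
qed

lemma Legendre_mod [simp]: "Legendre (a mod q) q = Legendre a q"
  by (simp add: Legendre_def QuadRes_def cong_def)

text \<open>Euler's criterion gives the identity modulo \<open>p\<close>. Both sides lie in {-1, 0,
  1}, so they differ by at most 2, which is less than \<open>p\<close>.\<close>

lemma Legendre_mult:
  assumes "prime p" "2 < p"
  shows "Legendre (a * b) (int p) = Legendre a (int p) * Legendre b (int p)"
proof -
  let ?L = "\<lambda>a. Legendre a (int p)"
  have "[?L (a * b) = (a * b) ^ ((p - 1) div 2)] (mod int p)"
    by (rule euler_criterion[OF assms])
  moreover have "[?L a * ?L b = a ^ ((p - 1) div 2) * b ^ ((p - 1) div 2)] (mod int p)"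
    by (intro cong_mult euler_criterion[OF assms])
  ultimately have "[?L (a * b) = ?L a * ?L b] (mod int p)"
    by (simp add: power_mult_distrib) (metis cong_sym cong_trans)
  then have "int p dvd ?L (a * b) - ?L a * ?L b"
    by (simp add: cong_iff_dvd_diff)
  moreover have "\<bar>?L (a * b) - ?L a * ?L b\<bar> \<le> 2"
    by (auto simp: Legendre_def)
  ultimately show ?thesis
    using assms(2) dvd_imp_le_int[of "?L (a * b) - ?L a * ?L b" "int p"] by fastforce
qed

lemma Legendre_eq_0_iff: "Legendre a q = 0 \<longleftrightarrow> q dvd a"
  by (auto simp: Legendre_def cong_0_iff)

text \<open>Squaring identifies 1 and \<open>p - 1\<close>, so it is not injective on the finite set
  of residues and hence misses one of them. The missed residue is nonzero because 0 is a
  square.\<close>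

lemma exists_nonresidue:
  assumes "prime p" "2 < p"
  obtains z where "Legendre z (int p) = -1"
proof -
  let ?I = "{0..<int p}"
  let ?sq = "\<lambda>y. y\<^sup>2 mod int p"
  have "?sq 1 = ?sq (int p - 1)"
  proof -
    have "(int p - 1)\<^sup>2 = 1 + int p * (int p - 2)"
      by (simp add: power2_eq_square algebra_simps)
    then show ?thesis by (metis mod_mult_self2 power_one)
  qed
  then have "\<not> inj_on ?sq ?I"
    using assms(2) inj_onD[of ?sq ?I 1 "int p - 1"] by auto
  moreover have "?sq ` ?I \<subseteq> ?I"
    using assms(2) by auto
  ultimately obtain z where z: "z \<in> ?I" "z \<notin> ?sq ` ?I"
    using finite_surj_inj[of ?I ?sq] by blast
  have "\<not> QuadRes (int p) z"
  proof
    assume "QuadRes (int p) z"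
    then obtain y where "[y\<^sup>2 = z] (mod int p)"
      by (auto simp: QuadRes_def)
    then have "?sq (y mod int p) = z"
      using z(1) by (simp add: cong_def power_mod)
    moreover have "y mod int p \<in> ?I"
      using assms(2) by auto
    ultimately show False
      using z(2) by blast
  qed
  moreover have "\<not> [z = 0] (mod int p)"
    using z assms(2) by (force simp: cong_def image_iff)
  ultimately show ?thesis
    by (intro that[of z]) (simp add: Legendre_def)
qed

text \<open>Multiplication by a nonresidue permutes the residues and flips the sign of every term,
  so the sum equals its own negative.\<close>

lemma sum_Legendre:
  assumes "prime p" "2 < p"
  shows "(\<Sum>x\<in>{0..<int p}. Legendre x (int p)) = 0"
proof -
  obtain z where z: "Legendre z (int p) = -1"
    using exists_nonresidue[OF assms] .
  then have "\<not> int p dvd z"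
    using Legendre_eq_0_iff[of z "int p"] by auto
  then have "coprime z (int p)"
    using assms(1) by (metis coprime_commute prime_imp_coprime prime_int_nat_transfer nat_int of_nat_0_le_iff)
  then have "(\<Sum>x\<in>{0..<int p}. Legendre x (int p)) = (\<Sum>x\<in>{0..<int p}. Legendre (z * x) (int p))"
    using sum_mod_scale[of "int p" z "\<lambda>x. Legendre x (int p)"] assms(2) by simp
  then show ?thesis
    by (simp add: Legendre_mult[OF assms] z sum_negf)
qed

lemma sum_Legendre_sq:
  assumes "prime p"
  shows "(\<Sum>x\<in>{0..<int p}. Legendre x (int p) * Legendre x (int p)) = int p - 1"
proof -
  have p: "p > 0" using assms prime_gt_0_nat by blast
  have "(\<Sum>x\<in>{0..<int p}. Legendre x (int p) * Legendre x (int p))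
      = (\<Sum>x\<in>{0..<int p}. if x = 0 then 0 else 1)"
    by (intro sum.cong) (auto simp: Legendre_def cong_0_iff dest: zdvd_imp_le)
  also have "\<dots> = int (card {x\<in>{0..<int p}. x \<noteq> 0})"
    by (subst card_eq_sum, subst of_nat_sum, rule sum.mono_neutral_cong_right) auto
  also have "{x\<in>{0..<int p}. x \<noteq> 0} = {1..<int p}"
    by auto
  finally show ?thesis using p by simp
qed

text \<open>The correlation is constant in \<open>t \<noteq> 0\<close> (substitute \<open>x = t z\<close>), and its sum over all \<open>t\<close>
  vanishes.\<close>

lemma Legendre_correlation:
  assumes "prime p" "2 < p"
  shows "(\<Sum>x\<in>{0..<int p}. Legendre x (int p) * Legendre (x + t) (int p))
    = (if int p dvd t then int p else 0) - 1"
proof -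
  let ?I = "{0..<int p}" and ?L = "\<lambda>x. Legendre x (int p)"
  define S where "S t = (\<Sum>x\<in>?I. ?L x * ?L (x + t))" for t
  have S_mod: "S (t mod int p) = S t" for t
    unfolding S_def by (intro sum.cong refl arg_cong2[where f = "(*)"])
      (metis Legendre_mod mod_add_right_eq)
  have S0: "S 0 = int p - 1"
    using sum_Legendre_sq[OF assms(1)] by (simp add: S_def)
  have S1: "S t = S 1" if "\<not> int p dvd t" for t
  proof -
    have co: "coprime t (int p)"
      using that assms(1)
      by (metis coprime_commute prime_imp_coprime prime_int_nat_transfer nat_int of_nat_0_le_iff)
    have sq: "?L t * ?L t = 1"
      using that by (auto simp: Legendre_def cong_0_iff)
    have "S t = (\<Sum>x\<in>?I. ?L ((t * x) mod int p) * ?L ((t * x) mod int p + t))"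
      unfolding S_def
      using sum_mod_scale[OF _ co, of "\<lambda>x. ?L x * ?L (x + t)"] assms(2) by simp
    also have "\<dots> = (\<Sum>x\<in>?I. (?L t * ?L t) * (?L x * ?L (x + 1)))"
    proof (intro sum.cong refl)
      fix x
      have "?L ((t * x) mod int p + t) = ?L (t * (x + 1))"
        by (metis Legendre_mod mod_add_left_eq distrib_left mult.right_neutral)
      then show "?L ((t * x) mod int p) * ?L ((t * x) mod int p + t)
          = (?L t * ?L t) * (?L x * ?L (x + 1))"
        by (simp add: Legendre_mult[OF assms])
    qed
    finally show ?thesis by (simp add: sq S_def)
  qed
  have "(\<Sum>t\<in>?I. S t) = (\<Sum>x\<in>?I. ?L x * (\<Sum>t\<in>?I. ?L (x + t)))"
    unfolding S_def by (subst sum.swap) (simp add: sum_distrib_left)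
  also have "\<dots> = 0"
  proof -
    have "(\<Sum>t\<in>?I. ?L (x + t)) = 0" for x
      using sum_mod_shift[of "int p" ?L x] sum_Legendre[OF assms] assms(2)
      by (simp add: add.commute)
    then show ?thesis by simp
  qed
  finally have "(\<Sum>t\<in>?I. S t) = 0" .
  moreover have "?I = insert 0 {1..<int p}"
    using assms(2) by auto
  moreover have "(\<Sum>t\<in>{1..<int p}. S t) = (\<Sum>t\<in>{1..<int p}. S 1)"
    by (intro sum.cong refl S1) (auto dest: zdvd_imp_le)
  \<comment> \<open>The total 0 is made up of \<open>S 0 = p - 1\<close> and of \<open>p - 1\<close>
    further terms, all equal to \<open>S 1\<close>.\<close>
  ultimately have "(int p - 1) * (S 1 + 1) = 0"
    using S0 assms(2) by (simp add: algebra_simps)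
  then have "S 1 = -1"
    using assms(2) by simp
  moreover have "S t = S 0" if "int p dvd t"
    using S_mod[of t] that by simp
  ultimately show ?thesis
    using S0 S1[of t] unfolding S_def[symmetric] by auto
qed

section \<open>Flatness of combinations of translated symbols\<close>

definition leg :: "nat \<Rightarrow> int \<Rightarrow> real" where
  "leg p x = of_int (Legendre x (int p))"

text \<open>The Legendre symbol vanishes at multiples of \<open>p\<close>. Raising it to 1 there
  makes every value a sign, as a cocycle with values in {1, -1} requires.\<close>

definition sleg :: "nat \<Rightarrow> int \<Rightarrow> real" where
  "sleg p x = leg p x + (if int p dvd x then 1 else 0)"

lemma sleg_values: "sleg p x = 1 \<or> sleg p x = -1"
  by (auto simp: sleg_def leg_def Legendre_def cong_0_iff)

lemma sleg_0 [simp]: "sleg p 0 = 1"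
  by (simp add: sleg_def leg_def Legendre_def)

lemma leg_mod [simp]: "leg p (x mod int p) = leg p x"
  by (simp add: leg_def)

lemma sleg_mod [simp]: "sleg p (x mod int p) = sleg p x"
  by (simp add: sleg_def dvd_mod_iff)

lemma sum_leg: "prime p \<Longrightarrow> 2 < p \<Longrightarrow> (\<Sum>x\<in>{0..<int p}. leg p x) = 0"
  unfolding leg_def of_int_sum[symmetric] by (simp add: sum_Legendre)

lemma leg_correlation:
  assumes "prime p" "2 < p"
  shows "(\<Sum>x\<in>{0..<int p}. leg p (x + a) * leg p (x + b))
    = (if int p dvd b - a then real p else 0) - 1"
proof -
  have "(\<Sum>x\<in>{0..<int p}. leg p (x + a) * leg p (x + b))
      = (\<Sum>x\<in>{0..<int p}. leg p ((x + a) mod int p) * leg p ((x + a) mod int p + (b - a)))"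
  proof (intro sum.cong refl)
    fix x
    have "leg p ((x + a) mod int p + (b - a)) = leg p (x + a + (b - a))"
      by (metis leg_mod mod_add_left_eq)
    then show "leg p (x + a) * leg p (x + b)
        = leg p ((x + a) mod int p) * leg p ((x + a) mod int p + (b - a))"
      by simp
  qed
  also have "\<dots> = (\<Sum>x\<in>{0..<int p}. leg p x * leg p (x + (b - a)))"
    using sum_mod_shift[of "int p" "\<lambda>x. leg p x * leg p (x + (b - a))" a] assms(2) by simp
  also have "\<dots> = of_int (\<Sum>x\<in>{0..<int p}. Legendre x (int p) * Legendre (x + (b - a)) (int p))"
    by (simp add: leg_def)
  finally show ?thesis
    by (simp add: Legendre_correlation[OF assms])
qed

lemma leg_flat:
  assumes "prime p" "2 < p"
  shows "(\<Sum>y\<in>{0..<int p}. (\<Sum>g\<in>{0..<int p}. m g * leg p (y + g))\<^sup>2)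
    \<le> real p * (\<Sum>g\<in>{0..<int p}. (m g)\<^sup>2)"
proof -
  let ?I = "{0..<int p}"
  have eq: "int p dvd h - g \<longleftrightarrow> h = g" if "g \<in> ?I" "h \<in> ?I" for g h
  proof
    assume "int p dvd h - g"
    then have "h mod int p = g mod int p"
      using mod_eq_dvd_iff by blast
    then show "h = g" using that by simp
  qed simp
  have "(\<Sum>y\<in>?I. (\<Sum>g\<in>?I. m g * leg p (y + g))\<^sup>2)
      = (\<Sum>y\<in>?I. \<Sum>g\<in>?I. \<Sum>h\<in>?I. m g * m h * (leg p (y + g) * leg p (y + h)))"
    unfolding power2_eq_square sum_product by (intro sum.cong refl) (simp add: mult_ac)
  also have "\<dots> = (\<Sum>g\<in>?I. \<Sum>h\<in>?I. \<Sum>y\<in>?I. m g * m h * (leg p (y + g) * leg p (y + h)))"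
    by (rule trans[OF sum.swap], rule sum.cong[OF refl], rule sum.swap)
  also have "\<dots> = (\<Sum>g\<in>?I. \<Sum>h\<in>?I. m g * m h * ((if h = g then real p else 0) - 1))"
    by (intro sum.cong refl) (simp add: sum_distrib_left[symmetric] leg_correlation[OF assms] eq)
  also have "\<dots> = (\<Sum>g\<in>?I. \<Sum>h\<in>?I. (if h = g then real p * (m g)\<^sup>2 else 0) - m g * m h)"
    by (intro sum.cong refl) (auto simp: power2_eq_square algebra_simps)
  also have "\<dots> = real p * (\<Sum>g\<in>?I. (m g)\<^sup>2) - (\<Sum>g\<in>?I. m g)\<^sup>2"
    unfolding power2_eq_square[of "sum m ?I"] sum_product by (simp add: sum_subtractf sum_distrib_left)
  finally show ?thesis by simp
qed

lemma sum_delta_mod: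
  fixes q y :: int and v :: "int \<Rightarrow> real"
  assumes "q > 0"
  shows "(\<Sum>h\<in>{0..<q}. v h * (if q dvd y + h then 1 else 0)) = v ((- y) mod q)"
proof -
  have "q dvd y + h \<longleftrightarrow> h = (- y) mod q" if "h \<in> {0..<q}" for h
  proof -
    have "q dvd y + h \<longleftrightarrow> q dvd h - (- y)" by (simp add: add.commute)
    also have "\<dots> \<longleftrightarrow> h mod q = (- y) mod q"
      by (simp add: mod_eq_dvd_iff)
    finally show ?thesis using that by simp
  qed
  then have "(\<Sum>h\<in>{0..<q}. v h * (if q dvd y + h then 1 else 0))
      = (\<Sum>h\<in>{0..<q}. if h = (- y) mod q then v h else 0)"
    by (intro sum.cong) auto
  then show ?thesis using assms by simp
qed

text \<open>Splitting off the correction at \<open>0\<close> costs only a factor \<open>(1 + 1 / sqrt p)\<^sup>2\<close>, by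
  \<open>(a + b)\<^sup>2 \<le> (1 + 1/r) a\<^sup>2 + (1 + r) b\<^sup>2\<close> with \<open>r = sqrt p\<close>.\<close>

lemma sleg_flat:
  assumes "prime p" "2 < p"
  shows "(\<Sum>y\<in>{0..<int p}. (\<Sum>g\<in>{0..<int p}. m g * sleg p (x + y + g))\<^sup>2)
    \<le> (sqrt p + 1)\<^sup>2 * (\<Sum>g\<in>{0..<int p}. (m g)\<^sup>2)"
proof -
  let ?I = "{0..<int p}"
  define r where "r = sqrt (real p)"
  have r: "r > 0" "r * r = real p"
    using assms(2) by (simp_all add: r_def)
  define a where "a y = (\<Sum>g\<in>?I. m g * leg p (y + g))" for y
  define b where "b y = m ((- y) mod int p)" for y
  have per: "(\<Sum>g\<in>?I. m g * sleg p (y mod int p + g)) = (\<Sum>g\<in>?I. m g * sleg p (y + g))" for y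
    by (intro sum.cong refl arg_cong2[where f = "(*)"]) (metis sleg_mod mod_add_left_eq)
  have "(\<Sum>y\<in>?I. (\<Sum>g\<in>?I. m g * sleg p (x + y + g))\<^sup>2)
      = (\<Sum>y\<in>?I. (\<Sum>g\<in>?I. m g * sleg p ((y + x) mod int p + g))\<^sup>2)"
    by (simp add: per add.commute[of _ x])
  also have "\<dots> = (\<Sum>y\<in>?I. (\<Sum>g\<in>?I. m g * sleg p (y + g))\<^sup>2)"
    using sum_mod_shift[of "int p" "\<lambda>y. (\<Sum>g\<in>?I. m g * sleg p (y + g))\<^sup>2" x] assms(2) by simp
  also have "\<dots> = (\<Sum>y\<in>?I. (a y + b y)\<^sup>2)"
    using sum_delta_mod[of "int p" m] assms(2)
    by (simp add: a_def b_def sleg_def distrib_left sum.distrib)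
  also have "\<dots> \<le> (\<Sum>y\<in>?I. (1 + 1 / r) * (a y)\<^sup>2 + (1 + r) * (b y)\<^sup>2)"
  proof (intro sum_mono)
    fix y
    have "0 \<le> (a y - r * b y)\<^sup>2 / r" using r by simp
    also have "\<dots> = (1 + 1 / r) * (a y)\<^sup>2 + (1 + r) * (b y)\<^sup>2 - (a y + b y)\<^sup>2"
      using r(1) by (simp add: field_simps power2_eq_square)
    finally show "(a y + b y)\<^sup>2 \<le> (1 + 1 / r) * (a y)\<^sup>2 + (1 + r) * (b y)\<^sup>2" by simp
  qed
  also have "\<dots> = (1 + 1 / r) * (\<Sum>y\<in>?I. (a y)\<^sup>2) + (1 + r) * (\<Sum>y\<in>?I. (b y)\<^sup>2)"
    by (simp add: sum.distrib sum_distrib_left)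
  also have "(\<Sum>y\<in>?I. (b y)\<^sup>2) = (\<Sum>y\<in>?I. (m y)\<^sup>2)"
    using sum_mod_scale[of "int p" "-1" "\<lambda>y. (m y)\<^sup>2"] assms(2) by (simp add: b_def)
  also have "(1 + 1 / r) * (\<Sum>y\<in>?I. (a y)\<^sup>2) \<le> (1 + 1 / r) * (real p * (\<Sum>y\<in>?I. (m y)\<^sup>2))"
    unfolding a_def using leg_flat[OF assms, of m] r(1) by (intro mult_left_mono) auto
  \<comment> \<open>Since r^2 = p, the two coefficients add up to (1 + 1/r) r^2 + (1 + r) = (r +
    1)^2.\<close>
  also have "(1 + 1 / r) * (real p * (\<Sum>y\<in>?I. (m y)\<^sup>2)) + (1 + r) * (\<Sum>y\<in>?I. (m y)\<^sup>2)
      = (r + 1)\<^sup>2 * (\<Sum>y\<in>?I. (m y)\<^sup>2)"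
    using r(1) unfolding r(2)[symmetric] by (simp add: field_simps power2_eq_square)
  finally show ?thesis by (simp add: r_def)
qed

section \<open>Inverting the modified symbol\<close>

text \<open>An inverse of \<open>sleg\<close> for correlation on Z/p. Correlating \<open>leg\<close>
  with \<open>sleg\<close> gives p times the delta function, minus 1, plus a multiple of
  \<open>leg\<close>. The added constant 1 cancels the -1, the delta term cancels the multiple of
  \<open>leg\<close>, and the denominator is the factor of the delta function that remains.\<close>

definition sleg_inverse :: "nat \<Rightarrow> int \<Rightarrow> real" where
  "sleg_inverse p h =
     (leg p h - leg p (-1) * (if h = 0 then 1 else 0) + 1) / (real p - leg p (-1))"

text \<open>It follows that the translates of \<open>sleg p\<close> span all functions on Z/p. The
  identity is applied digit by digit in \<open>sg_cyl_in_cyc_closure\<close>.\<close>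

lemma sleg_inverse:
  assumes "prime p" "2 < p"
  shows "(\<Sum>h\<in>{0..<int p}. sleg_inverse p h * sleg p (y + h)) = (if int p dvd y then 1 else 0)"
proof -
  let ?I = "{0..<int p}" and ?d = "\<lambda>y. if int p dvd y then 1 else (0::real)"
  have p0: "real p - leg p (-1) \<noteq> 0"
    using assms(2) by (auto simp: leg_def Legendre_def)
  have 1: "(\<Sum>h\<in>?I. leg p h * leg p (y + h)) = real p * ?d y - 1"
    using leg_correlation[OF assms, of 0 y] by (simp add: add.commute)
  have 2: "(\<Sum>h\<in>?I. leg p h * ?d (y + h)) = leg p (-1) * leg p y"
    using sum_delta_mod[of "int p" "leg p" y] Legendre_mult[OF assms, of "-1" y] assms(2)
    by (simp add: leg_def)
  have 3: "(\<Sum>h\<in>?I. leg p (y + h)) = 0"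
    using sum_mod_shift[of "int p" "leg p" y] sum_leg[OF assms] assms(2) by (simp add: add.commute)
  have 4: "(\<Sum>h\<in>?I. ?d (y + h)) = 1"
    using sum_delta_mod[of "int p" "\<lambda>_. 1" y] assms(2) by simp
  have "(\<Sum>h\<in>?I. sleg_inverse p h * sleg p (y + h)) * (real p - leg p (-1))
      = (\<Sum>h\<in>?I. (leg p h - leg p (-1) * (if h = 0 then 1 else 0) + 1) * sleg p (y + h))"
    unfolding sum_distrib_right sleg_inverse_def using p0 by (intro sum.cong refl) simp
  also have "\<dots> = (\<Sum>h\<in>?I. leg p h * leg p (y + h) + leg p h * ?d (y + h)
      + (leg p (y + h) + ?d (y + h)) - (if h = 0 then leg p (-1) * (leg p y + ?d y) else 0))"
    by (intro sum.cong refl) (simp add: sleg_def algebra_simps)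
  also have "\<dots> = (real p * ?d y - 1) + leg p (-1) * leg p y + (0 + 1)
      - leg p (-1) * (leg p y + ?d y)"
    unfolding sum_subtractf sum.distrib 1 2 3 4 using assms(2) by simp
  also have "\<dots> = ?d y * (real p - leg p (-1))"
    by (simp add: algebra_simps)
  finally show ?thesis using p0 by simp
qed

section \<open>The action on digits and sheets\<close>

text \<open>The carrier is the whole real line with the complement of [0,2) a null set. Facts that
  rely on there being exactly two sheets therefore hold only almost everywhere.\<close>

definition unif02 :: "real measure" where
  "unif02 = uniform_measure lborel {0..<2}"

lemma sets_unif02 [measurable_cong, simp]: "sets unif02 = sets borel"
  by (simp add: unif02_def)

lemma space_unif02 [simp]: "space unif02 = UNIV"
  by (simp add: unif02_def)

lemma prob_space_unif02: "prob_space unif02"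
  unfolding unif02_def by (intro prob_space_uniform_measure) auto

interpretation unif02: prob_space unif02
  by (rule prob_space_unif02)

lemma emeasure_unif02:
  "A \<in> sets borel \<Longrightarrow> emeasure unif02 A = emeasure lborel ({0..<2} \<inter> A) / 2"
  by (simp add: unif02_def)

lemma AE_unif02: "AE y in unif02. y \<in> {0..<2}"
  unfolding unif02_def by (rule AE_uniform_measureI) auto

lemma emeasure_lborel_translate:
  fixes B :: "real set"
  assumes "B \<in> sets borel"
  shows "emeasure lborel {y. y + t \<in> B} = emeasure lborel B"
proof -
  have "emeasure lborel B = emeasure (distr lborel borel ((+) t)) B"
    by (simp add: lborel_distr_plus)
  also have "\<dots> = emeasure lborel {y. y + t \<in> B}"
    using assms by (subst emeasure_distr) (auto simp: vimage_def add.commute)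
  finally show ?thesis ..
qed

text \<open>The map translates each cell of length 1/Q rigidly, by an amount depending only on the
  integer-valued cell number.\<close>

lemma measurable_cell_map:
  fixes \<pi> :: "int \<Rightarrow> int"
  assumes \<tau>: "\<And>y. \<tau> y = y + (of_int (\<pi> \<lfloor>real Q * y\<rfloor>) - of_int \<lfloor>real Q * y\<rfloor>) / real Q"
  shows "\<tau> \<in> borel_measurable borel"
proof -
  have fl: "(\<lambda>y::real. \<lfloor>real Q * y\<rfloor>) \<in> measurable borel (count_space UNIV)"
    by measurable
  have "(\<lambda>y::real. y + (of_int (\<pi> \<lfloor>real Q * y\<rfloor>) - of_int \<lfloor>real Q * y\<rfloor>) / real Q) \<in> borel_measurable borel"
    using measurable_compose[OF fl, of "\<lambda>k. (of_int (\<pi> k) - of_int k) / real Q" borel]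
    by (intro borel_measurable_add) simp_all
  moreover have "\<tau> = (\<lambda>y. y + (of_int (\<pi> \<lfloor>real Q * y\<rfloor>) - of_int \<lfloor>real Q * y\<rfloor>) / real Q)"
    by (rule ext) (rule \<tau>)
  ultimately show ?thesis by simp
qed

text \<open>The interval [0,2) is the disjoint union of 2Q cells. On cell \<open>k\<close> the map
  is a translation onto cell \<open>\<pi> k\<close>, so the preimage of \<open>A\<close> has in cell
  \<open>k\<close> the measure that \<open>A\<close> has in cell \<open>\<pi> k\<close>. Summing
  over the cells and reindexing by the bijection gives invariance.\<close>

lemma distr_cell_permutation:
  fixes \<pi> :: "int \<Rightarrow> int"
  assumes Q: "Q > 0" and bij: "bij_betw \<pi> {0..<2 * int Q} {0..<2 * int Q}"
    and \<tau>: "\<And>y. \<tau> y = y + (of_int (\<pi> \<lfloor>real Q * y\<rfloor>) - of_int \<lfloor>real Q * y\<rfloor>) / real Q"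
  shows "distr unif02 unif02 \<tau> = unif02"
proof (rule measure_eqI)
  have \<tau>m: "\<tau> \<in> borel_measurable borel"
    by (rule measurable_cell_map[of _ _ Q]) (rule \<tau>)
  have \<tau>m' [measurable]: "\<tau> \<in> measurable unif02 unif02"
    using \<tau>m by (simp add: measurable_cong_sets[of unif02 borel unif02 borel])
  define cell where "cell k = {y::real. \<lfloor>real Q * y\<rfloor> = k}" for k :: int
  have cellm: "cell k \<in> sets borel" for k
    unfolding cell_def by measurable
  let ?I = "{0..<2 * int Q}"
  have cells: "{0..<2} = (\<Union>k\<in>?I. cell k)"
  proof (intro equalityI subsetI)
    fix y :: real assume "y \<in> {0..<2}"
    then have "0 \<le> real Q * y" "real Q * y < real_of_int (2 * int Q)"
      using Q by auto
    then have "0 \<le> \<lfloor>real Q * y\<rfloor>" "\<lfloor>real Q * y\<rfloor> < 2 * int Q"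
      by (simp_all add: zero_le_floor floor_less_iff)
    then show "y \<in> (\<Union>k\<in>?I. cell k)"
      by (auto simp: cell_def)
  next
    fix y assume "y \<in> (\<Union>k\<in>?I. cell k)"
    then have "0 \<le> \<lfloor>real Q * y\<rfloor>" "\<lfloor>real Q * y\<rfloor> < 2 * int Q"
      by (auto simp: cell_def)
    then have "0 \<le> real Q * y" "real Q * y < of_int (2 * int Q)"
      by (simp_all only: zero_le_floor floor_less_iff)
    then show "y \<in> {0..<2}"
      using Q mult_less_cancel_left_pos[of "real Q" y 2] by (simp add: zero_le_mult_iff mult.commute)
  qed
  have decomp: "emeasure lborel ({0..<2} \<inter> A) = (\<Sum>k\<in>?I. emeasure lborel (cell k \<inter> A))"
    if "A \<in> sets borel" for A
  proof -
    have "(\<Sum>k\<in>?I. emeasure lborel (cell k \<inter> A)) = emeasure lborel (\<Union>k\<in>?I. cell k \<inter> A)"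
      using cellm that by (intro sum_emeasure) (auto simp: disjoint_family_on_def cell_def)
    then show ?thesis by (simp only: cells UN_extend_simps)
  qed
  show "sets (distr unif02 unif02 \<tau>) = sets unif02" by simp
  fix A assume "A \<in> sets (distr unif02 unif02 \<tau>)"
  then have A: "A \<in> sets borel" by simp
  have vA: "\<tau> -` A \<in> sets borel"
    using measurable_sets[OF \<tau>m A] by simp
  have shift: "emeasure lborel (cell k \<inter> \<tau> -` A) = emeasure lborel (cell (\<pi> k) \<inter> A)" for k
  proof -
    let ?t = "(of_int (\<pi> k) - of_int k) / real Q"
    have "y + ?t \<in> cell (\<pi> k) \<longleftrightarrow> y \<in> cell k" for y
    proof -
      have "real Q * (y + ?t) = real Q * y + of_int (\<pi> k - k)"
        using Q by (simp add: field_simps)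
      then show ?thesis by (auto simp: cell_def simp del: of_int_diff)
    qed
    then have "cell k \<inter> \<tau> -` A = {y. y + ?t \<in> cell (\<pi> k) \<inter> A}"
      by (auto simp: cell_def \<tau>)
    then show ?thesis
      using cellm A by (simp only: emeasure_lborel_translate sets.Int)
  qed
  have "emeasure (distr unif02 unif02 \<tau>) A = emeasure unif02 (\<tau> -` A)"
    using A by (simp add: emeasure_distr)
  also have "\<dots> = (\<Sum>k\<in>?I. emeasure lborel (cell (\<pi> k) \<inter> A)) / 2"
    using vA by (simp add: emeasure_unif02 decomp shift)
  also have "(\<Sum>k\<in>?I. emeasure lborel (cell (\<pi> k) \<inter> A)) = (\<Sum>k\<in>?I. emeasure lborel (cell k \<inter> A))"
    by (rule sum.reindex_bij_betw[OF bij])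
  also have "\<dots> / 2 = emeasure unif02 A"
    using A by (simp add: emeasure_unif02 decomp)
  finally show "emeasure (distr unif02 unif02 \<tau>) A = emeasure unif02 A" .
qed

section \<open>The sheet sign and the exchange of the sheets\<close>

definition sg :: "real \<Rightarrow> real" where
  "sg y = (if even \<lfloor>y\<rfloor> then 1 else -1)"

definition swap_sheet :: "real \<Rightarrow> real" where
  "swap_sheet y = y + sg y"

lemma sg_measurable [measurable]: "sg \<in> borel_measurable borel"
  unfolding sg_def[abs_def] by measurable

lemma sg_values: "sg y = 1 \<or> sg y = -1"
  by (simp add: sg_def)

lemma sg_mult_self [simp]: "sg y * sg y = 1"
  by (simp add: sg_def)

lemma abs_sg [simp]: "\<bar>sg y\<bar> = 1"
  by (simp add: sg_def)

lemma floor_swap_sheet: "\<lfloor>swap_sheet y\<rfloor> = \<lfloor>y\<rfloor> + (if even \<lfloor>y\<rfloor> then 1 else -1)"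
  by (auto simp: swap_sheet_def sg_def) linarith+

lemma sg_swap_sheet [simp]: "sg (swap_sheet y) = - sg y"
  unfolding sg_def floor_swap_sheet by simp

text \<open>Brings the swap into the shape expected by the two cell lemmas, with
  \<open>Q = 1\<close>, which explains the factors \<open>real 1\<close>.\<close>

lemma swap_sheet_cell:
  "swap_sheet y = y + (of_int (\<lfloor>real 1 * y\<rfloor> + (if even \<lfloor>real 1 * y\<rfloor> then 1 else -1))
    - of_int \<lfloor>real 1 * y\<rfloor>) / real 1"
  by (simp add: swap_sheet_def sg_def)

lemma swap_sheet_measurable [measurable]: "swap_sheet \<in> measurable unif02 unif02"
  using measurable_cell_map[of swap_sheet "\<lambda>k. k + (if even k then 1 else -1)" 1, OF swap_sheet_cell]
  by (simp add: measurable_cong_sets[of unif02 borel unif02 borel])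

lemma distr_swap_sheet: "distr unif02 unif02 swap_sheet = unif02"
proof (rule distr_cell_permutation[of 1 "\<lambda>k. k + (if even k then 1 else -1)"])
  have I: "{0..<2 * int 1} = {0, 1}" by auto
  show "bij_betw (\<lambda>k. k + (if even k then 1 else -1)) {0..<2 * int 1} {0..<2 * int 1}"
    unfolding I by (auto simp: bij_betw_def)
qed (simp, rule swap_sheet_cell)

locale prime_seq =
  fixes p :: "nat \<Rightarrow> nat"
  assumes prime_p: "\<And>n. prime (p n)" and large_p: "\<And>n. 5 ^ (2 * (n + 1)) \<le> p n"
begin

lemma p_gt_2: "2 < p n"
proof -
  have "(5::nat) ^ 2 \<le> 5 ^ (2 * (n + 1))"
    by (rule power_increasing) auto
  then have "5 ^ 2 \<le> p n" using large_p[of n] by (rule order.trans)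
  then show ?thesis by simp
qed

lemma p_pos [simp]: "0 < p n" "p n \<noteq> 0"
  using p_gt_2[of n] by auto

section \<open>Mixed radix digits\<close>

definition P :: "nat \<Rightarrow> nat" where
  "P N = (\<Prod>i<N. p i)"

lemma P_0 [simp]: "P 0 = 1" and P_Suc [simp]: "P (Suc N) = P N * p N"
  by (simp_all add: P_def)

lemma P_pos [simp]: "0 < P N" "P N \<noteq> 0"
  by (simp_all add: P_def)

lemma P_ge: "2 ^ N \<le> P N"
  by (induction N) (use p_gt_2 in \<open>auto intro!: mult_mono simp: mult.commute[of 2] less_imp_le\<close>)

lemma P_dvd:
  assumes "N \<le> n"
  shows "P N * p n dvd P (Suc n)"
proof -
  have "P N dvd P n"
    unfolding P_def by (rule prod_dvd_prod_subset) (use assms in auto)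
  then show ?thesis by simp
qed

text \<open>Place \<open>n\<close> has base \<open>p n\<close>, and \<open>P n\<close> is the place
  value. Adding an integer to \<open>y\<close> changes the floor by a multiple of
  \<open>p n\<close>, so digits do not see the sheet.\<close>

definition dig :: "nat \<Rightarrow> real \<Rightarrow> int" where
  "dig n y = \<lfloor>real (P (Suc n)) * y\<rfloor> mod int (p n)"

lemma dig_range [simp]: "0 \<le> dig n y" "dig n y < int (p n)"
  by (simp_all add: dig_def)

lemma dig_mod [simp]: "dig n y mod int (p n) = dig n y"
  by (simp add: dig_def)

lemma dig_measurable [measurable]: "dig n \<in> measurable borel (count_space UNIV)"
  unfolding dig_def[abs_def] by measurable

lemma floor_P_div: "\<lfloor>real (P n) * y\<rfloor> = \<lfloor>real (P (Suc n)) * y\<rfloor> div int (p n)"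
  using floor_divide_real_eq_div[of "int (p n)" "real (P (Suc n)) * y"] by simp

lemma floor_P_Suc: "\<lfloor>real (P (Suc n)) * y\<rfloor> = int (p n) * \<lfloor>real (P n) * y\<rfloor> + dig n y"
  by (simp only: floor_P_div[of n y] dig_def mult_div_mod_eq)

text \<open>The cell number at level \<open>N\<close> encodes the integer part and the first
  \<open>N\<close> digits: division with remainder by the bases recovers them, and
  \<open>floor_P_Suc\<close> reassembles the number.\<close>

lemma floor_P_eq_iff:
  "\<lfloor>real (P N) * y\<rfloor> = \<lfloor>real (P N) * z\<rfloor> \<longleftrightarrow> \<lfloor>y\<rfloor> = \<lfloor>z\<rfloor> \<and> (\<forall>n<N. dig n y = dig n z)"
proof (induction N)
  case (Suc N)
  have "\<lfloor>real (P (Suc N)) * y\<rfloor> = \<lfloor>real (P (Suc N)) * z\<rfloor>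
      \<longleftrightarrow> \<lfloor>real (P N) * y\<rfloor> = \<lfloor>real (P N) * z\<rfloor> \<and> dig N y = dig N z"
    using floor_P_div floor_P_Suc dig_def by metis
  then show ?case
    using Suc.IH by (auto simp: less_Suc_eq)
qed simp

text \<open>Such points share a cell of length at most (1/2)^N for every \<open>N\<close>.
  Identities between orbits can thus be checked digit by digit.\<close>

lemma digit_ext:
  assumes "\<lfloor>y\<rfloor> = \<lfloor>z\<rfloor>" "\<And>n. dig n y = dig n z"
  shows "y = z"
proof (rule ccontr)
  assume "y \<noteq> z"
  then obtain N where N: "1 / \<bar>y - z\<bar> < 2 ^ N"
    using real_arch_pow[of 2 "1 / \<bar>y - z\<bar>"] by auto
  have "\<lfloor>real (P N) * y\<rfloor> = \<lfloor>real (P N) * z\<rfloor>"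
    using assms floor_P_eq_iff by blast
  then have "\<bar>real (P N) * y - real (P N) * z\<bar> < 1"
    by linarith
  then have "real (P N) * \<bar>y - z\<bar> < 1"
    by (simp add: abs_mult flip: right_diff_distrib)
  moreover have "2 ^ N \<le> real (P N)"
    using P_ge[of N] by (metis of_nat_le_iff of_nat_numeral of_nat_power)
  ultimately have "2 ^ N * \<bar>y - z\<bar> < 1"
    by (meson abs_ge_zero mult_right_mono order_le_less_trans)
  then show False
    using N \<open>y \<noteq> z\<close> by (simp add: field_simps)
qed

primrec numb :: "(nat \<Rightarrow> int) \<Rightarrow> int \<Rightarrow> nat \<Rightarrow> int" where
  "numb a e 0 = e"
| "numb a e (Suc N) = int (p N) * numb a e N + a N"

text \<open>The point with integer part \<open>e\<close> and first \<open>N\<close> digits \<open>a\<close> that continues like \<open>y\<close>.\<close>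

definition put :: "nat \<Rightarrow> (nat \<Rightarrow> int) \<Rightarrow> int \<Rightarrow> real \<Rightarrow> real" where
  "put N a e y = y + (of_int (numb a e N) - of_int \<lfloor>real (P N) * y\<rfloor>) / real (P N)"

text \<open>At level \<open>N\<close> this holds by construction. Going down one level divides by
  \<open>p M\<close>, which strips the last digit because that digit lies in range.\<close>

lemma floor_P_put:
  assumes "\<And>n. n < N \<Longrightarrow> 0 \<le> a n \<and> a n < int (p n)" "M \<le> N"
  shows "\<lfloor>real (P M) * put N a e y\<rfloor> = numb a e M"
  using assms(2)
proof (induction rule: inc_induct)
  case base
  have "real (P N) * put N a e y = real (P N) * y + of_int (numb a e N - \<lfloor>real (P N) * y\<rfloor>)"
    by (simp add: put_def field_simps)
  then show ?case by (simp del: of_int_diff)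
next
  case (step M)
  then show ?case
    using assms(1)[of M] by (simp add: floor_P_div[of M])
qed

lemma floor_put:
  assumes "\<And>n. n < N \<Longrightarrow> 0 \<le> a n \<and> a n < int (p n)"
  shows "\<lfloor>put N a e y\<rfloor> = e"
  using floor_P_put[of N a 0 e y] assms by simp

lemma dig_put_less:
  assumes "\<And>n. n < N \<Longrightarrow> 0 \<le> a n \<and> a n < int (p n)" "n < N"
  shows "dig n (put N a e y) = a n"
  using floor_P_put[of N a "Suc n" e y] assms by (simp add: dig_def)

text \<open>The point moves by an integer multiple of \<open>1 / P N\<close>, and
  \<open>P N * p n\<close> divides \<open>P (Suc n)\<close>. The scaled point thus moves by a
  multiple of \<open>p n\<close>.\<close>

lemma dig_put_ge:
  assumes "N \<le> n"
  shows "dig n (put N a e y) = dig n y"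
proof -
  obtain k where k: "P (Suc n) = P N * p n * k"
    using P_dvd[OF assms] by (elim dvdE)
  define t where "t = numb a e N - \<lfloor>real (P N) * y\<rfloor>"
  have "real (P (Suc n)) * put N a e y = real (P (Suc n)) * y + of_int (int (p n) * (int k * t))"
    unfolding k by (simp add: put_def t_def field_simps)
  then have "\<lfloor>real (P (Suc n)) * put N a e y\<rfloor> = \<lfloor>real (P (Suc n)) * y\<rfloor> + int (p n) * (int k * t)"
    by (simp only: floor_add_int)
  then show ?thesis by (simp add: dig_def)
qed

section \<open>The cocycle and the action\<close>

text \<open>Formally the coboundary of the divergent product of \<open>sleg (p n) (dig n y)\<close>
  over all \<open>n\<close>. Digits not moved by \<open>g\<close> cancel, so for \<open>g\<close> in
  \<open>Gset p\<close> a finite product remains.\<close>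

definition \<phi> :: "(nat \<Rightarrow> int) \<Rightarrow> real \<Rightarrow> real" where
  "\<phi> g y = (\<Prod>n | g n \<noteq> 0. sleg (p n) (dig n y + g n) * sleg (p n) (dig n y))"

definition bnd :: "(nat \<Rightarrow> int) \<Rightarrow> nat" where
  "bnd g = (LEAST N. \<forall>n\<ge>N. g n = 0)"

text \<open>Digits are shifted without carry, and the sheet is exchanged when the cocycle is -1. The
  exchange pairs each even integer with its successor, which defines the map on all of the real line
  and preserves [0,2).\<close>

definition T :: "(nat \<Rightarrow> int) \<Rightarrow> real \<Rightarrow> real" where
  "T g y = put (bnd g) (\<lambda>n. (dig n y + g n) mod int (p n))
     (if \<phi> g y = 1 then \<lfloor>y\<rfloor> else \<lfloor>y\<rfloor> + (if even \<lfloor>y\<rfloor> then 1 else -1)) y"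

lemma sleg_sq [simp]: "sleg q x * sleg q x = 1"
  using sleg_values[of q x] by auto

lemma \<phi>_values: "\<phi> g y = 1 \<or> \<phi> g y = -1"
proof -
  have "\<phi> g y * \<phi> g y = 1"
    unfolding \<phi>_def prod.distrib[symmetric]
    by (rule prod.neutral) (metis mult.assoc mult.commute mult.right_neutral sleg_sq)
  then show ?thesis by (simp add: square_eq_1_iff)
qed

lemma \<phi>_eq:
  assumes "\<And>n. N \<le> n \<Longrightarrow> g n = 0"
  shows "\<phi> g y = (\<Prod>n<N. sleg (p n) (dig n y + g n) * sleg (p n) (dig n y))"
  unfolding \<phi>_def by (rule prod.mono_neutral_left) (use assms in \<open>auto simp: not_less[symmetric]\<close>)

lemma Gset_bounded:
  assumes "g \<in> Gset p"
  obtains N where "\<And>n. N \<le> n \<Longrightarrow> g n = 0"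
proof -
  have "finite {n. g n \<noteq> 0}" using assms by (simp add: Gset_def)
  then obtain N where "\<forall>n\<in>{n. g n \<noteq> 0}. n < N"
    using finite_nat_set_iff_bounded by auto
  then show ?thesis by (intro that[of N]) force
qed

lemma bnd:
  assumes "g \<in> Gset p" "bnd g \<le> n"
  shows "g n = 0"
proof -
  obtain N where "\<forall>n\<ge>N. g n = 0"
    using Gset_bounded[OF assms(1)] by blast
  then have "\<forall>n\<ge>bnd g. g n = 0"
    unfolding bnd_def by (rule LeastI)
  then show ?thesis using assms(2) by blast
qed

lemma dig_T:
  assumes "g \<in> Gset p"
  shows "dig n (T g y) = (dig n y + g n) mod int (p n)"
proof (cases "n < bnd g")
  case True
  then show ?thesis unfolding T_def by (subst dig_put_less) auto
next
  case False
  then show ?thesis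
    unfolding T_def by (subst dig_put_ge) (auto simp: bnd[OF assms])
qed

lemma floor_T:
  "\<lfloor>T g y\<rfloor> = (if \<phi> g y = 1 then \<lfloor>y\<rfloor> else \<lfloor>y\<rfloor> + (if even \<lfloor>y\<rfloor> then 1 else -1))"
  unfolding T_def by (rule floor_put) auto

lemma sg_T: "sg (T g y) = sg y * \<phi> g y"
  using \<phi>_values[of g y] by (auto simp: sg_def floor_T)

lemma sleg_add_mod [simp]: "sleg q (x mod int q + a) = sleg q (x + a)" "sleg q (a + x mod int q) = sleg q (a + x)"
  by (metis sleg_mod mod_add_left_eq, metis sleg_mod mod_add_right_eq)

lemma Gset_zero [simp]: "(\<lambda>_. 0) \<in> Gset p"
  by (simp add: Gset_def)

lemma Gset_add:
  assumes "g \<in> Gset p" "h \<in> Gset p"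
  shows "Gadd p g h \<in> Gset p"
proof -
  have "{n. Gadd p g h n \<noteq> 0} \<subseteq> {n. g n \<noteq> 0} \<union> {n. h n \<noteq> 0}"
    by (auto simp: Gadd_def)
  moreover have "finite ({n. g n \<noteq> 0} \<union> {n. h n \<noteq> 0})"
    using assms by (simp add: Gset_def)
  ultimately show ?thesis
    using finite_subset by (auto simp: Gset_def Gadd_def)
qed

definition neg :: "(nat \<Rightarrow> int) \<Rightarrow> (nat \<Rightarrow> int)" where
  "neg g = (\<lambda>n. (- g n) mod int (p n))"

lemma Gset_mod [simp]: "g \<in> Gset p \<Longrightarrow> g n mod int (p n) = g n"
  by (simp add: Gset_def)

lemma Gset_neg:
  assumes "g \<in> Gset p"
  shows "neg g \<in> Gset p"
proof -
  have "{n. neg g n \<noteq> 0} \<subseteq> {n. g n \<noteq> 0}"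
    by (auto simp: neg_def)
  then show ?thesis
    using assms finite_subset by (auto simp: Gset_def neg_def)
qed

lemma neg_neg:
  assumes "g \<in> Gset p"
  shows "neg (neg g) = g"
  using Gset_mod[OF assms] by (simp add: neg_def mod_simps)

lemma Gadd_neg: "Gadd p (neg g) g = (\<lambda>_. 0)" "Gadd p g (neg g) = (\<lambda>_. 0)"
  by (simp_all add: Gadd_def neg_def mod_simps)

lemma T_zero: "T (\<lambda>_. 0) y = y"
  by (rule digit_ext) (simp_all add: floor_T dig_T \<phi>_def)

text \<open>Over a common range of digits, the sign at the intermediate point \<open>T h y\<close>
  occurs twice and cancels.\<close>

lemma \<phi>_add:
  assumes "g \<in> Gset p" "h \<in> Gset p"
  shows "\<phi> (Gadd p g h) y = \<phi> g (T h y) * \<phi> h y"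
proof -
  obtain N1 where N1: "\<And>n. N1 \<le> n \<Longrightarrow> g n = 0" using Gset_bounded[OF assms(1)] by blast
  obtain N2 where N2: "\<And>n. N2 \<le> n \<Longrightarrow> h n = 0" using Gset_bounded[OF assms(2)] by blast
  define N where "N = max N1 N2"
  have N: "g n = 0" "h n = 0" "Gadd p g h n = 0" if "N \<le> n" for n
    using that N1[of n] N2[of n] by (simp_all add: N_def Gadd_def)
  have "(\<Prod>n<N. sleg (p n) (dig n y + Gadd p g h n) * sleg (p n) (dig n y))
    = (\<Prod>n<N. (sleg (p n) (dig n (T h y) + g n) * sleg (p n) (dig n (T h y)))
        * (sleg (p n) (dig n y + h n) * sleg (p n) (dig n y)))"
  proof (intro prod.cong refl)
    fix n
    have 1: "sleg (p n) (dig n y + Gadd p g h n) = sleg (p n) (dig n (T h y) + g n)"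
      using assms by (simp add: Gadd_def dig_T add_ac)
    have 2: "sleg (p n) (dig n (T h y)) = sleg (p n) (dig n y + h n)"
      using assms by (simp add: dig_T)
    show "sleg (p n) (dig n y + Gadd p g h n) * sleg (p n) (dig n y)
      = (sleg (p n) (dig n (T h y) + g n) * sleg (p n) (dig n (T h y)))
        * (sleg (p n) (dig n y + h n) * sleg (p n) (dig n y))"
      unfolding 1 2 by simp
  qed
  then show ?thesis
    using \<phi>_eq[of N g, OF N(1)] \<phi>_eq[of N h, OF N(2)] \<phi>_eq[of N "Gadd p g h", OF N(3)]
    by (simp only: prod.distrib)
qed

lemma T_add:
  assumes "g \<in> Gset p" "h \<in> Gset p"
  shows "T (Gadd p g h) y = T g (T h y)"
proof (rule digit_ext)
  show "\<lfloor>T (Gadd p g h) y\<rfloor> = \<lfloor>T g (T h y)\<rfloor>"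
    using \<phi>_values[of g "T h y"] \<phi>_values[of h y]
    by (auto simp: floor_T \<phi>_add[OF assms])
  show "dig n (T (Gadd p g h) y) = dig n (T g (T h y))" for n
    unfolding dig_T[OF Gset_add[OF assms]] using assms by (simp add: dig_T Gadd_def mod_simps add_ac)
qed

lemma T_neg:
  assumes "g \<in> Gset p"
  shows "T (neg g) (T g y) = y" "T g (T (neg g) y) = y"
  using T_add[OF Gset_neg[OF assms] assms, of y] T_add[OF assms Gset_neg[OF assms], of y]
  by (simp_all add: Gadd_neg T_zero)

text \<open>The swap adds an integer, so it leaves all digits, and with them the cocycle,
  unchanged.\<close>

lemma T_swap_sheet:
  assumes "g \<in> Gset p"
  shows "sg (T g (swap_sheet y)) = - sg (T g y)"
proof -
  have "dig n (swap_sheet y) = dig n y" for n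
  proof -
    have "real (P (Suc n)) * swap_sheet y
        = real (P (Suc n)) * y + of_int (int (p n) * (int (P n) * (if even \<lfloor>y\<rfloor> then 1 else -1)))"
      by (simp add: swap_sheet_def sg_def algebra_simps)
    then have "\<lfloor>real (P (Suc n)) * swap_sheet y\<rfloor>
        = \<lfloor>real (P (Suc n)) * y\<rfloor> + int (p n) * (int (P n) * (if even \<lfloor>y\<rfloor> then 1 else -1))"
      by (simp only: floor_add_int)
    then show ?thesis by (simp add: dig_def)
  qed
  then show ?thesis by (simp add: sg_T \<phi>_def)
qed

text \<open>Once \<open>N\<close> bounds the support of \<open>g\<close>, the cell of
  \<open>T g y\<close> depends only on the cell of \<open>y\<close> and may be computed at its left
  end point. This is the form needed for the cell lemmas.\<close>

lemma T_cell:
  assumes g: "g \<in> Gset p" and N: "N = bnd g"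
  shows "T g y = y + (of_int \<lfloor>real (P N) * T g (of_int \<lfloor>real (P N) * y\<rfloor> / real (P N))\<rfloor>
      - of_int \<lfloor>real (P N) * y\<rfloor>) / real (P N)"
proof -
  define z where "z = of_int \<lfloor>real (P N) * y\<rfloor> / real (P N)"
  have "\<lfloor>real (P N) * y\<rfloor> = \<lfloor>real (P N) * z\<rfloor>"
    by (simp add: z_def)
  then have yz: "\<lfloor>y\<rfloor> = \<lfloor>z\<rfloor>" "\<And>n. n < N \<Longrightarrow> dig n y = dig n z"
    by (auto simp: floor_P_eq_iff)
  have "\<phi> g y = \<phi> g z"
    using \<phi>_eq[of N g, OF bnd[OF g]] by (simp add: N yz(2)[unfolded N])
  then have "\<lfloor>T g y\<rfloor> = \<lfloor>T g z\<rfloor>" "\<And>n. n < N \<Longrightarrow> dig n (T g y) = dig n (T g z)"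
    by (simp_all add: floor_T yz dig_T[OF g])
  then have "\<lfloor>real (P N) * T g y\<rfloor> = \<lfloor>real (P N) * T g z\<rfloor>"
    by (simp add: floor_P_eq_iff)
  moreover have "T g y = y + (of_int \<lfloor>real (P N) * T g y\<rfloor> - of_int \<lfloor>real (P N) * y\<rfloor>) / real (P N)"
  proof -
    let ?a = "\<lambda>n. (dig n y + g n) mod int (p n)"
    let ?e = "if \<phi> g y = 1 then \<lfloor>y\<rfloor> else \<lfloor>y\<rfloor> + (if even \<lfloor>y\<rfloor> then 1 else -1)"
    have T: "T g y = put N ?a ?e y" by (simp add: T_def N)
    have "\<lfloor>real (P N) * put N ?a ?e y\<rfloor> = numb ?a ?e N"
      by (rule floor_P_put) auto
    then show ?thesis
      unfolding T by (simp add: put_def)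
  qed
  ultimately show ?thesis unfolding z_def by simp
qed

lemma T_measurable_borel:
  assumes g: "g \<in> Gset p"
  shows "T g \<in> borel_measurable borel"
  by (rule measurable_cell_map[where Q = "P (bnd g)"
        and \<pi> = "\<lambda>k. \<lfloor>real (P (bnd g)) * T g (of_int k / real (P (bnd g)))\<rfloor>"])
     (rule T_cell[OF g refl])

lemma T_measurable [measurable (raw)]:
  assumes g: "g \<in> Gset p"
  shows "T g \<in> measurable unif02 unif02"
  using T_measurable_borel[OF g] by (simp add: measurable_cong_sets[of unif02 borel unif02 borel])

text \<open>On cells of level \<open>bnd g\<close> the action is a permutation: it preserves the
  sheets 0 and 1, which contain exactly the first \<open>2 * P N\<close> cells, and it is injective
  because \<open>T (neg g)\<close> undoes it.\<close>

lemma distr_T: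
  assumes g: "g \<in> Gset p"
  shows "distr unif02 unif02 (T g) = unif02"
proof -
  define N where "N = bnd g"
  define \<pi> where "\<pi> k = \<lfloor>real (P N) * T g (of_int k / real (P N))\<rfloor>" for k :: int
  have Tk: "T g (of_int k / real (P N)) = of_int (\<pi> k) / real (P N)" for k
    using T_cell[OF g N_def, of "of_int k / real (P N)"]
    by (simp add: \<pi>_def field_simps)
  let ?I = "{0..<2 * int (P N)}"
  have range: "k \<in> ?I \<longleftrightarrow> \<lfloor>(of_int k :: real) / real (P N)\<rfloor> \<in> {0, 1}" for k
  proof -
    have "k \<in> ?I \<longleftrightarrow> k div int (P N) \<in> {0, 1}"
    proof
      assume "k \<in> ?I"
      then have k: "0 \<le> k div int (P N)" "k < 2 * int (P N)"
        using P_pos(1)[of N] by (auto simp: pos_imp_zdiv_nonneg_iff)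
      have "\<not> 2 \<le> k div int (P N)"
      proof
        assume "2 \<le> k div int (P N)"
        then have "2 * int (P N) \<le> k div int (P N) * int (P N)"
          by (rule mult_right_mono) simp
        moreover have "k div int (P N) * int (P N) \<le> k"
          using div_mult_mod_eq[of k "int (P N)"] pos_mod_sign[of "int (P N)" k] P_pos(1)[of N]
          by linarith
        ultimately show False using k(2) by linarith
      qed
      then have "0 \<le> k div int (P N)" "k div int (P N) < 2"
        using k by simp_all
      then show "k div int (P N) \<in> {0, 1}" by auto
    next
      assume "k div int (P N) \<in> {0, 1}"
      moreover have "0 \<le> k mod int (P N)" "k mod int (P N) < int (P N)" by simp_all
      ultimately show "k \<in> ?I"
        using div_mult_mod_eq[of k "int (P N)"]
        unfolding atLeastLessThan_iff by (elim insertE emptyE) (simp only: mult_1 mult_zero_left, linarith)+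
    qed
    then show ?thesis
      by (simp add: floor_divide_of_int_eq[where 'a = real, of k "int (P N)", simplified])
  qed
  have "inj_on \<pi> ?I"
  proof (rule inj_onI)
    fix k l assume "\<pi> k = \<pi> l"
    then have "T g (of_int k / real (P N)) = T g (of_int l / real (P N))"
      by (simp add: Tk)
    then have "(of_int k :: real) / real (P N) = of_int l / real (P N)"
      by (metis T_neg(1)[OF g])
    then show "k = l" by simp
  qed
  moreover have "\<pi> ` ?I \<subseteq> ?I"
  proof
    fix l assume "l \<in> \<pi> ` ?I"
    then obtain k where k: "k \<in> ?I" "l = \<pi> k" by blast
    have "\<lfloor>T g (of_int k / real (P N))\<rfloor> \<in> {0, 1}"
      using k(1) unfolding range floor_T by auto
    then show "l \<in> ?I"
      unfolding range k(2) Tk .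
  qed
  ultimately have "bij_betw \<pi> ?I ?I"
    by (simp add: bij_betw_def endo_inj_surj)
  then show ?thesis
  proof (rule distr_cell_permutation[OF P_pos(1)])
    show "T g y = y + (of_int (\<pi> \<lfloor>real (P N) * y\<rfloor>) - of_int \<lfloor>real (P N) * y\<rfloor>) / real (P N)" for y
      unfolding \<pi>_def by (rule T_cell[OF g N_def])
  qed
qed

section \<open>Finite subgroups and the flatness estimate\<close>

definition GN :: "nat \<Rightarrow> (nat \<Rightarrow> int) set" where
  "GN N = {g \<in> Gset p. \<forall>n\<ge>N. g n = 0}"

lemma GN_0: "GN 0 = {\<lambda>_. 0}"
  by (auto simp: GN_def Gset_def)

lemma GN_Suc: "GN (Suc N) = (\<lambda>(g, h). g(N := h)) ` (GN N \<times> {0..<int (p N)})"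
proof (intro equalityI subsetI)
  fix g assume g: "g \<in> GN (Suc N)"
  have "finite {n. (g(N := 0)) n \<noteq> 0}"
    by (rule finite_subset[of _ "{n. g n \<noteq> 0}"]) (use g in \<open>auto simp: GN_def Gset_def\<close>)
  then have "g(N := 0) \<in> GN N"
    using g by (auto simp: GN_def Gset_def)
  moreover have "g N \<in> {0..<int (p N)}"
    using g by (simp add: GN_def Gset_def)
  ultimately show "g \<in> (\<lambda>(g, h). g(N := h)) ` (GN N \<times> {0..<int (p N)})"
    by (intro image_eqI[of _ _ "(g(N := 0), g N)"]) auto
next
  fix g' assume "g' \<in> (\<lambda>(g, h). g(N := h)) ` (GN N \<times> {0..<int (p N)})"
  then obtain g h where gh: "g' = g(N := h)" "g \<in> GN N" "0 \<le> h" "h < int (p N)" by auto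
  have "finite {n. g' n \<noteq> 0}"
    by (rule finite_subset[of _ "insert N {n. g n \<noteq> 0}"])
       (use gh in \<open>auto simp: GN_def Gset_def\<close>)
  moreover have "0 \<le> g' n \<and> g' n < int (p n)" "Suc N \<le> n \<Longrightarrow> g' n = 0" for n
    using gh by (auto simp: GN_def Gset_def)
  ultimately show "g' \<in> GN (Suc N)"
    by (simp add: GN_def Gset_def)
qed

lemma inj_GN: "inj_on (\<lambda>(g, h). g(N := h)) (GN N \<times> {0..<int (p N)})"
proof (rule inj_onI, clarify)
  fix g h g' h' assume a: "g \<in> GN N" "g' \<in> GN N" and eq: "g(N := h) = g'(N := (h'::int))"
  have "g n = g' n" for n
    using fun_cong[OF eq, of n] a by (cases "n = N") (auto simp: GN_def)
  then show "g = g' \<and> h = h'" using fun_cong[OF eq, of N] by auto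
qed

lemma finite_GN [simp]: "finite (GN N)"
  by (induction N) (auto simp: GN_0 GN_Suc)

lemma card_GN: "card (GN N) = P N"
proof (induction N)
  case (Suc N)
  then show ?case
    unfolding GN_Suc by (simp add: card_image[OF inj_GN] card_cartesian_product)
qed (simp add: GN_0)

lemma sum_GN_Suc:
  "(\<Sum>g\<in>GN (Suc N). F g) = (\<Sum>g\<in>GN N. \<Sum>h\<in>{0..<int (p N)}. F (g(N := h)))"
  unfolding GN_Suc sum.reindex[OF inj_GN] sum.cartesian_product
  by (intro sum.cong) auto

lemma sum_GN_prod:
  fixes F :: "nat \<Rightarrow> int \<Rightarrow> real"
  shows "(\<Sum>g\<in>GN N. \<Prod>n<N. F n (g n)) = (\<Prod>n<N. \<Sum>h\<in>{0..<int (p n)}. F n h)"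
proof (induction N)
  case (Suc N)
  have "(\<Sum>g\<in>GN (Suc N). \<Prod>n<Suc N. F n (g n))
      = (\<Sum>g\<in>GN N. \<Sum>h\<in>{0..<int (p N)}. (\<Prod>n<N. F n (g n)) * F N h)"
    unfolding sum_GN_Suc by simp
  then show ?case
    by (simp add: Suc.IH[symmetric] sum_product)
qed (simp add: GN_0)

text \<open>Flatness passes to products. Summing out coordinate \<open>N\<close> of \<open>g\<close>
  first leaves, for each value \<open>k\<close> of the last coordinate of \<open>h\<close>,
  coefficients \<open>m' k\<close> on the first \<open>N\<close> coordinates. The induction
  hypothesis applies for fixed \<open>k\<close>, and \<open>sleg_flat\<close> bounds the sum over
  \<open>k\<close> for fixed \<open>g\<close>.\<close>

lemma product_flat:
  "(\<Sum>h\<in>GN N. (\<Sum>g\<in>GN N. m g * (\<Prod>n<N. sleg (p n) (x n + h n + g n)))\<^sup>2)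
    \<le> (\<Prod>n<N. (sqrt (p n) + 1)\<^sup>2) * (\<Sum>g\<in>GN N. (m g)\<^sup>2)"
proof (induction N arbitrary: m)
  case (Suc N)
  let ?I = "{0..<int (p N)}"
  let ?\<Pi> = "\<lambda>g h. \<Prod>n<N. sleg (p n) (x n + h n + g n)"
  define m' where "m' k g = (\<Sum>l\<in>?I. m (g(N := l)) * sleg (p N) (x N + k + l))" for k g
  have "(\<Sum>h\<in>GN (Suc N). (\<Sum>g\<in>GN (Suc N). m g * (\<Prod>n<Suc N. sleg (p n) (x n + h n + g n)))\<^sup>2)
    = (\<Sum>h\<in>GN N. \<Sum>k\<in>?I. (\<Sum>g\<in>GN N. m' k g * ?\<Pi> g h)\<^sup>2)"
    unfolding sum_GN_Suc m'_def
    by (intro sum.cong refl arg_cong[where f = "\<lambda>x. x\<^sup>2"])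
       (auto simp: sum_distrib_right sum_distrib_left mult_ac intro!: sum.cong)
  also have "\<dots> = (\<Sum>k\<in>?I. \<Sum>h\<in>GN N. (\<Sum>g\<in>GN N. m' k g * ?\<Pi> g h)\<^sup>2)"
    by (rule sum.swap)
  also have "\<dots> \<le> (\<Sum>k\<in>?I. (\<Prod>n<N. (sqrt (p n) + 1)\<^sup>2) * (\<Sum>g\<in>GN N. (m' k g)\<^sup>2))"
    by (intro sum_mono Suc.IH)
  also have "\<dots> = (\<Prod>n<N. (sqrt (p n) + 1)\<^sup>2) * (\<Sum>g\<in>GN N. \<Sum>k\<in>?I. (m' k g)\<^sup>2)"
    by (simp add: sum_distrib_left sum.swap[of _ "GN N"])
  also have "\<dots> \<le> (\<Prod>n<N. (sqrt (p n) + 1)\<^sup>2)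
      * (\<Sum>g\<in>GN N. (sqrt (p N) + 1)\<^sup>2 * (\<Sum>l\<in>?I. (m (g(N := l)))\<^sup>2))"
    unfolding m'_def
    by (intro mult_left_mono sum_mono sleg_flat prime_p p_gt_2 prod_nonneg) auto
  also have "\<dots> = (\<Prod>n<Suc N. (sqrt (p n) + 1)\<^sup>2) * (\<Sum>g\<in>GN (Suc N). (m g)\<^sup>2)"
    unfolding sum_GN_Suc by (simp add: sum_distrib_left mult_ac)
  finally show ?case .
qed (simp add: GN_0)

text \<open>Since 1/sqrt(p n) is at most (1/5)^(n+1), the bound 1 + x <= exp x reduces the product
  to a geometric series with sum at most 1/2. The value 33/20 bounds exp(1/2) because e < 2.72 <
  2.7225 = (33/20)^2.\<close>

lemma flat_constant: "(\<Prod>n<N. (sqrt (p n) + 1)\<^sup>2) \<le> 33 / 20 * real (P N)"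
proof -
  have 1: "(sqrt (p n) + 1)\<^sup>2 \<le> real (p n) * exp (2 * (1 / 5) ^ (n + 1))" for n
  proof -
    have "(5 ^ (n + 1))\<^sup>2 \<le> real (p n)"
      using large_p[of n] by (metis mult.commute of_nat_le_iff of_nat_numeral of_nat_power power_mult)
    then have "5 ^ (n + 1) \<le> sqrt (p n)"
      using real_le_rsqrt by blast
    then have "1 \<le> sqrt (p n) * (1 / 5) ^ (n + 1)"
      by (simp add: power_one_over field_simps)
    then have "sqrt (p n) + 1 \<le> sqrt (p n) * (1 + (1 / 5) ^ (n + 1))"
      by (simp add: algebra_simps)
    also have "\<dots> \<le> sqrt (p n) * exp ((1 / 5) ^ (n + 1))"
      by (intro mult_left_mono exp_ge_add_one_self) auto
    finally have "(sqrt (p n) + 1)\<^sup>2 \<le> (sqrt (p n) * exp ((1 / 5) ^ (n + 1)))\<^sup>2"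
      by (intro power_mono) auto
    then show ?thesis
      by (simp add: power_mult_distrib exp_double[symmetric])
  qed
  have "(\<Prod>n<N. (sqrt (p n) + 1)\<^sup>2) \<le> (\<Prod>n<N. real (p n) * exp (2 * (1 / 5) ^ (n + 1)))"
    using 1 by (intro prod_mono) auto
  also have "\<dots> = real (P N) * exp (\<Sum>n<N. 2 * (1 / 5) ^ (n + 1))"
    by (simp add: prod.distrib P_def exp_sum)
  also have "(\<Sum>n<N. 2 * (1 / 5 :: real) ^ (n + 1)) = 1 / 2 - (1 / 5) ^ N / 2"
    by (induction N) simp_all
  also have "exp (1 / 2 - (1 / 5 :: real) ^ N / 2) \<le> exp (1 / 2)"
    by simp
  also have "exp (1 / 2 :: real) \<le> 33 / 20"
  proof (rule power2_le_imp_le)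
    have "(exp (1 / 2 :: real))\<^sup>2 = exp 1"
      by (simp add: exp_double[symmetric])
    also have "\<dots> \<le> (33 / 20)\<^sup>2"
      using e_less_272 by (simp add: power2_eq_square)
    finally show "(exp (1 / 2 :: real))\<^sup>2 \<le> (33 / 20)\<^sup>2" .
  qed simp
  finally show ?thesis by (simp add: mult.commute)
qed

lemma Gset_finite_bounded:
  assumes "finite S" "S \<subseteq> Gset p"
  obtains N where "S \<subseteq> GN N"
proof -
  have "bnd g \<le> Max (insert 0 (bnd ` S))" if "g \<in> S" for g
    using that assms(1) by (intro Max_ge) auto
  then have "S \<subseteq> GN (Max (insert 0 (bnd ` S)))"
    using assms(2) bnd by (fastforce simp: GN_def)
  then show ?thesis by (rule that)
qed

lemma integral_T:
  fixes f :: "real \<Rightarrow> real"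
  assumes "g \<in> Gset p" "f \<in> borel_measurable borel"
  shows "(\<integral>y. f (T g y) \<partial>unif02) = (\<integral>y. f y \<partial>unif02)"
proof -
  have "(\<integral>y. f y \<partial>unif02) = (\<integral>y. f y \<partial>distr unif02 unif02 (T g))"
    by (simp add: distr_T assms)
  also have "\<dots> = (\<integral>y. f (T g y) \<partial>unif02)"
    using assms by (intro integral_distr) auto
  finally show ?thesis ..
qed

lemma bounded_integrable:
  fixes f :: "real \<Rightarrow> real"
  assumes "f \<in> borel_measurable borel" "\<And>y. \<bar>f y\<bar> \<le> B"
  shows "integrable unif02 f"
  by (rule unif02.integrable_const_bound[of _ B]) (use assms in auto)

lemma sgT_measurable:
  assumes "g \<in> Gset p"
  shows "(\<lambda>y. sg (T g y)) \<in> borel_measurable borel"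
  using measurable_compose[OF T_measurable_borel[OF assms] sg_measurable] .

text \<open>By invariance the left side equals its average over the translates by \<open>GN N\<close>, which is
  bounded pointwise.\<close>

lemma sg_flat:
  assumes S: "finite S" "S \<subseteq> Gset p"
  shows "(\<integral>y. (\<Sum>g\<in>S. m g * sg (T g y))\<^sup>2 \<partial>unif02) \<le> 33 / 20 * (\<Sum>g\<in>S. (m g)\<^sup>2)"
proof -
  obtain N where N: "S \<subseteq> GN N" using Gset_finite_bounded[OF S] .
  have GN_G: "g \<in> Gset p" if "g \<in> GN N" for g using that by (simp add: GN_def)
  define m' where "m' g = (if g \<in> S then m g else 0)" for g
  define F where "F y = (\<Sum>g\<in>GN N. m' g * sg (T g y))" for y
  have ext: "(\<Sum>g\<in>S. m g * u g) = (\<Sum>g\<in>GN N. m' g * u g)" for u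
    using N by (intro sum.mono_neutral_cong_left) (auto simp: m'_def)
  have ext2: "(\<Sum>g\<in>S. (m g)\<^sup>2) = (\<Sum>g\<in>GN N. (m' g)\<^sup>2)"
    using N by (intro sum.mono_neutral_cong_left) (auto simp: m'_def)
  have Fm: "F \<in> borel_measurable borel"
    unfolding F_def[abs_def] using sgT_measurable[OF GN_G] by measurable
  have FTm: "(\<lambda>y. F (T h y)) \<in> borel_measurable borel" if "h \<in> GN N" for h
    using measurable_compose[OF T_measurable_borel[OF GN_G[OF that]] Fm] .
  have Fb: "\<bar>F y\<bar> \<le> (\<Sum>g\<in>GN N. \<bar>m' g\<bar>)" for y
    unfolding F_def by (rule order.trans[OF sum_abs]) (simp add: abs_mult)
  have Fi: "integrable unif02 (\<lambda>y. (F (T h y))\<^sup>2)" if "h \<in> GN N" for h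
  proof (rule bounded_integrable)
    show "(\<lambda>y. (F (T h y))\<^sup>2) \<in> borel_measurable borel"
      using FTm[OF that] by measurable
    show "\<bar>(F (T h y))\<^sup>2\<bar> \<le> (\<Sum>g\<in>GN N. \<bar>m' g\<bar>)\<^sup>2" for y
      using power_mono[OF Fb[of "T h y"], of 2] by simp
  qed
  have pt: "(\<Sum>h\<in>GN N. (F (T h y))\<^sup>2) \<le> 33 / 20 * real (P N) * (\<Sum>g\<in>GN N. (m' g)\<^sup>2)" for y
  proof -
    \<comment> \<open>The factors depending on neither \<open>g\<close> nor \<open>h\<close> form a
      single sign, which disappears on squaring.\<close>
    define w where "w = sg y * (\<Prod>n<N. sleg (p n) (dig n y))"
    have "w * w = (sg y * sg y) * (\<Prod>n<N. sleg (p n) (dig n y) * sleg (p n) (dig n y))"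
      by (simp add: w_def prod.distrib mult_ac del: sleg_sq sg_mult_self)
    then have w: "w\<^sup>2 = 1" by (simp add: power2_eq_square)
    have sgTT: "sg (T g (T h y)) = w * (\<Prod>n<N. sleg (p n) (dig n y + h n + g n))"
      if "g \<in> GN N" "h \<in> GN N" for g h
    proof -
      have "sg (T g (T h y)) = sg y * \<phi> (Gadd p g h) y"
        using that by (simp add: T_add[symmetric] GN_G sg_T)
      also have "\<phi> (Gadd p g h) y
          = (\<Prod>n<N. sleg (p n) (dig n y + Gadd p g h n) * sleg (p n) (dig n y))"
        by (rule \<phi>_eq) (use that in \<open>auto simp: GN_def Gadd_def\<close>)
      also have "\<dots> = (\<Prod>n<N. sleg (p n) (dig n y + h n + g n) * sleg (p n) (dig n y))"
        by (simp add: Gadd_def add_ac)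
      finally show ?thesis by (simp add: w_def prod.distrib mult_ac)
    qed
    have "(\<Sum>h\<in>GN N. (F (T h y))\<^sup>2)
        = (\<Sum>h\<in>GN N. (\<Sum>g\<in>GN N. m' g * (\<Prod>n<N. sleg (p n) (dig n y + h n + g n)))\<^sup>2)"
    proof (intro sum.cong refl)
      fix h assume h: "h \<in> GN N"
      have "F (T h y) = w * (\<Sum>g\<in>GN N. m' g * (\<Prod>n<N. sleg (p n) (dig n y + h n + g n)))"
        unfolding F_def sum_distrib_left using h by (intro sum.cong refl) (simp add: sgTT mult_ac)
      then show "(F (T h y))\<^sup>2 = (\<Sum>g\<in>GN N. m' g * (\<Prod>n<N. sleg (p n) (dig n y + h n + g n)))\<^sup>2"
        by (simp add: power_mult_distrib w)
    qed
    also have "\<dots> \<le> (\<Prod>n<N. (sqrt (p n) + 1)\<^sup>2) * (\<Sum>g\<in>GN N. (m' g)\<^sup>2)"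
      by (rule product_flat)
    also have "\<dots> \<le> 33 / 20 * real (P N) * (\<Sum>g\<in>GN N. (m' g)\<^sup>2)"
      by (intro mult_right_mono flat_constant sum_nonneg) auto
    finally show ?thesis .
  qed
  have "real (P N) * (\<integral>y. (F y)\<^sup>2 \<partial>unif02) = (\<Sum>h\<in>GN N. \<integral>y. (F (T h y))\<^sup>2 \<partial>unif02)"
  proof -
    have "(\<integral>y. (F (T h y))\<^sup>2 \<partial>unif02) = (\<integral>y. (F y)\<^sup>2 \<partial>unif02)" if "h \<in> GN N" for h
      using integral_T[OF GN_G[OF that], of "\<lambda>y. (F y)\<^sup>2"] Fm by simp
    then show ?thesis by (simp add: card_GN)
  qed
  also have "\<dots> = (\<integral>y. (\<Sum>h\<in>GN N. (F (T h y))\<^sup>2) \<partial>unif02)"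
    using Fi by (simp add: Bochner_Integration.integral_sum)
  also have "\<dots> \<le> (\<integral>y. 33 / 20 * real (P N) * (\<Sum>g\<in>GN N. (m' g)\<^sup>2) \<partial>unif02)"
    by (intro integral_mono Bochner_Integration.integrable_sum Fi pt) auto
  also have "\<dots> = real (P N) * (33 / 20 * (\<Sum>g\<in>GN N. (m' g)\<^sup>2))"
    using unif02.prob_space by simp
  finally have "(\<integral>y. (F y)\<^sup>2 \<partial>unif02) \<le> 33 / 20 * (\<Sum>g\<in>GN N. (m' g)\<^sup>2)"
    by (simp only: mult_le_cancel_left_pos of_nat_0_less_iff P_pos)
  then show ?thesis by (simp add: F_def ext ext2)
qed

end

section \<open>Failure of approximate transitivity\<close>

context prime_seq
begin

section \<open>Invariance of integrability, null sets and measures\<close>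

lemma borel_measurable_unif02: "f \<in> borel_measurable unif02 \<longleftrightarrow> f \<in> borel_measurable borel"
  by (simp only: measurable_cong_sets[OF sets_unif02 refl])

lemma integrable_T:
  fixes f :: "real \<Rightarrow> real"
  assumes "g \<in> Gset p" "integrable unif02 f"
  shows "integrable unif02 (\<lambda>y. f (T g y))"
proof -
  have "integrable (distr unif02 unif02 (T g)) f"
    using assms by (simp add: distr_T)
  then show ?thesis
    using assms T_measurable by (subst (asm) integrable_distr_eq) auto
qed

lemma AE_T:
  assumes "g \<in> Gset p" "AE y in unif02. Q y"
  shows "AE y in unif02. Q (T g y)"
  by (rule AE_distrD[OF T_measurable[OF assms(1)]]) (simp only: distr_T[OF assms(1)] assms(2))

lemma measure_T_vimage:
  assumes "g \<in> Gset p" "B \<in> sets borel"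
  shows "measure unif02 {y. T g y \<in> B} = measure unif02 B"
proof -
  have "measure unif02 B = measure (distr unif02 unif02 (T g)) B"
    by (simp add: distr_T assms)
  also have "\<dots> = measure unif02 {y. T g y \<in> B}"
    using assms T_measurable by (subst measure_distr) (auto simp: vimage_def)
  finally show ?thesis ..
qed

text \<open>The sheet swap preserves the measure and negates \<open>sg\<close>.\<close>

lemma integral_sg: "(\<integral>y. sg y \<partial>unif02) = 0"
proof -
  have "(\<integral>y. sg y \<partial>unif02) = (\<integral>y. sg y \<partial>distr unif02 unif02 swap_sheet)"
    by (simp add: distr_swap_sheet)
  also have "\<dots> = (\<integral>y. sg (swap_sheet y) \<partial>unif02)"
    by (intro integral_distr) auto
  finally show ?thesis by simp
qed

section \<open>Bounding the total weight of large coefficients\<close>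

lemma integrable_mult_bounded:
  fixes f u :: "real \<Rightarrow> real"
  assumes "integrable unif02 f" "u \<in> borel_measurable borel" "\<And>y. \<bar>u y\<bar> \<le> C"
  shows "integrable unif02 (\<lambda>y. f y * u y)"
proof (rule Bochner_Integration.integrable_bound[where f = "\<lambda>y. C * f y"])
  show "integrable unif02 (\<lambda>y. C * f y)" using assms(1) by simp
  show "(\<lambda>y. f y * u y) \<in> borel_measurable unif02"
    using borel_measurable_integrable[OF assms(1)] assms(2) by measurable
  have "\<bar>f y\<bar> * \<bar>u y\<bar> \<le> \<bar>C\<bar> * \<bar>f y\<bar>" for y
    using assms(3)[of y] by (metis abs_ge_self abs_ge_zero mult.commute mult_left_mono order.trans)
  then show "AE y in unif02. norm (f y * u y) \<le> norm (C * f y)"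
    by (simp add: abs_mult)
qed

text \<open>The part of the combination carried by coefficients larger than \<open>11/5 \<cdot> \<mu>(B)\<close> lives, up to
  the mass of \<open>f\<close> off \<open>B\<close>, on a set too small to carry its share of the bounded function \<open>F\<close>.\<close>

lemma heavy_mass:
  fixes f F :: "real \<Rightarrow> real"
  assumes S: "finite S" "S \<subseteq> Gset p" and l: "\<And>g. g \<in> S \<Longrightarrow> 0 \<le> l g"
    and f: "integrable unif02 f" "AE y in unif02. 0 \<le> f y" "(\<integral>y. f y \<partial>unif02) = 1"
    and F: "F \<in> borel_measurable borel" "\<And>y. 0 \<le> F y" "\<And>y. F y \<le> 2"
    and approx: "(\<integral>y. \<bar>F y - (\<Sum>g\<in>S. l g * f (T g y))\<bar> \<partial>unif02) \<le> \<epsilon>"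
    and B: "B \<in> sets borel" and off: "(\<integral>y. f y * indicator (- B) y \<partial>unif02) \<le> \<eta>"
    and H: "H = {g \<in> S. 11 / 5 * measure unif02 B < l g}"
  shows "(\<Sum>g\<in>H. l g) * (1 / 11 - \<eta>) \<le> \<epsilon>"
proof -
  define \<beta> where "\<beta> = measure unif02 B"
  define h where "h y = (\<Sum>g\<in>S. l g * f (T g y))" for y
  define U where "U = (\<Union>g\<in>H. {y. T g y \<in> B})"
  have HS: "H \<subseteq> S" "finite H" using H S(1) by auto
  have HG: "g \<in> Gset p" if "g \<in> H" for g using that HS S by auto
  have lH: "0 \<le> l g" if "g \<in> H" for g using that HS l by auto
  have TB: "{y. T g y \<in> B} \<in> sets borel" if "g \<in> H" for g
    using measurable_sets[OF T_measurable_borel[OF HG[OF that]] B] by (simp add: vimage_def)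
  have Um: "U \<in> sets borel" unfolding U_def using TB HS(2) by blast
  have fB: "integrable unif02 (\<lambda>y. f y * indicator B y)"
    and fB': "integrable unif02 (\<lambda>y. f y * indicator (- B) y)"
    using B by (auto intro!: integrable_mult_bounded[of _ _ 1] f simp: indicator_def)
  have hi: "integrable unif02 h"
    unfolding h_def using S by (intro Bochner_Integration.integrable_sum integrable_mult_right integrable_T f) auto
  have Fi: "integrable unif02 F"
    by (rule bounded_integrable[of _ 2]) (use F in \<open>auto simp: abs_le_iff intro: order.trans[of _ 0]\<close>)
  have di: "integrable unif02 (\<lambda>y. \<bar>F y - h y\<bar>)"
    using hi Fi by simp
  have \<beta>U: "measure unif02 U \<le> real (card H) * \<beta>"
  proof -
    have "measure unif02 U \<le> (\<Sum>g\<in>H. measure unif02 {y. T g y \<in> B})"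
      unfolding U_def using TB HS(2) by (intro unif02.finite_measure_subadditive_finite) auto
    also have "\<dots> = real (card H) * \<beta>"
      by (simp add: measure_T_vimage HG B \<beta>_def)
    finally show ?thesis .
  qed
  \<comment> \<open>The mass of \<open>f\<close> splits into the part on \<open>B\<close>,
    transported by \<open>T g\<close>, and the part off \<open>B\<close>.\<close>
  have split: "1 = (\<integral>y. f (T g y) * indicator B (T g y) \<partial>unif02) + (\<integral>y. f y * indicator (- B) y \<partial>unif02)"
    if "g \<in> H" for g
  proof -
    have "1 = (\<integral>y. f y * indicator B y + f y * indicator (- B) y \<partial>unif02)"
      unfolding f(3)[symmetric] by (intro Bochner_Integration.integral_cong) (auto simp: indicator_def)
    also have "\<dots> = (\<integral>y. f y * indicator B y \<partial>unif02) + (\<integral>y. f y * indicator (- B) y \<partial>unif02)"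
      by (rule Bochner_Integration.integral_add[OF fB fB'])
    also have "(\<integral>y. f y * indicator B y \<partial>unif02) = (\<integral>y. f (T g y) * indicator B (T g y) \<partial>unif02)"
      using integral_T[OF HG[OF that], of "\<lambda>y. f y * indicator B y"]
        borel_measurable_integrable[OF fB] by (simp add: borel_measurable_unif02)
    finally show ?thesis .
  qed
  have TBi: "integrable unif02 (\<lambda>y. f (T g y) * indicator B (T g y))" if "g \<in> H" for g
    using integrable_T[OF HG[OF that] fB] by simp
  have "(\<Sum>g\<in>H. l g) = (\<Sum>g\<in>H. l g * (\<integral>y. f (T g y) * indicator B (T g y) \<partial>unif02)
      + l g * (\<integral>y. f y * indicator (- B) y \<partial>unif02))"
    by (intro sum.cong refl) (metis distrib_left mult.right_neutral split)
  also have "\<dots> = (\<integral>y. (\<Sum>g\<in>H. l g * (f (T g y) * indicator B (T g y))) \<partial>unif02)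
      + (\<Sum>g\<in>H. l g) * (\<integral>y. f y * indicator (- B) y \<partial>unif02)"
    using TBi by (simp add: sum.distrib sum_distrib_right Bochner_Integration.integral_sum)
  \<comment> \<open>On \<open>U\<close> the heavy part is at most \<open>h\<close>, hence at most
    \<open>F\<close> plus the error, and \<open>F\<close> is bounded by 2. Off \<open>U\<close> it
    vanishes.\<close>
  also have "(\<integral>y. (\<Sum>g\<in>H. l g * (f (T g y) * indicator B (T g y))) \<partial>unif02)
      \<le> (\<integral>y. 2 * indicator U y + \<bar>F y - h y\<bar> \<partial>unif02)"
  proof (rule integral_mono_AE)
    show "integrable unif02 (\<lambda>y. \<Sum>g\<in>H. l g * (f (T g y) * indicator B (T g y)))"
      using TBi by (intro Bochner_Integration.integrable_sum integrable_mult_right) auto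
    show "integrable unif02 (\<lambda>y. 2 * indicator U y + \<bar>F y - h y\<bar>)"
      using di Um by (intro Bochner_Integration.integrable_add)
        (auto intro!: bounded_integrable[of _ 2] simp: indicator_def)
    have "AE y in unif02. \<forall>g\<in>S. 0 \<le> f (T g y)"
      using S by (subst AE_finite_all) (auto intro!: AE_T f(2))
    then show "AE y in unif02. (\<Sum>g\<in>H. l g * (f (T g y) * indicator B (T g y)))
        \<le> 2 * indicator U y + \<bar>F y - h y\<bar>"
    proof (eventually_elim)
      case (elim y)
      show ?case
      proof (cases "y \<in> U")
        case True
        have "(\<Sum>g\<in>H. l g * (f (T g y) * indicator B (T g y))) \<le> (\<Sum>g\<in>H. l g * f (T g y))"
          using elim HS lH by (intro sum_mono mult_left_mono) (auto simp: indicator_def)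
        also have "\<dots> \<le> h y"
          unfolding h_def using elim HS l S by (intro sum_mono2) auto
        also have "\<dots> \<le> 2 + \<bar>F y - h y\<bar>" using F(3)[of y] by linarith
        finally show ?thesis using True by simp
      next
        case False
        then have "(\<Sum>g\<in>H. l g * (f (T g y) * indicator B (T g y))) = 0"
          by (intro sum.neutral) (auto simp: U_def indicator_def)
        then show ?thesis using False by simp
      qed
    qed
  qed
  also have "\<dots> = 2 * measure unif02 U + (\<integral>y. \<bar>F y - h y\<bar> \<partial>unif02)"
  proof -
    have "integrable unif02 (\<lambda>y. 2 * indicator U y :: real)"
      using Um by (auto intro!: bounded_integrable[of _ 2] simp: indicator_def)
    from Bochner_Integration.integral_add[OF this di] show ?thesis
      using Um by simp
  qed
  also have "\<dots> \<le> 2 * (real (card H) * \<beta>) + \<epsilon>"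
    using \<beta>U approx by (simp add: h_def)
  also have "(\<Sum>g\<in>H. l g) * (\<integral>y. f y * indicator (- B) y \<partial>unif02) \<le> (\<Sum>g\<in>H. l g) * \<eta>"
    using off lH by (intro mult_left_mono sum_nonneg) auto
  finally have 1: "(\<Sum>g\<in>H. l g) \<le> 2 * (real (card H) * \<beta>) + \<epsilon> + (\<Sum>g\<in>H. l g) * \<eta>"
    by simp
  \<comment> \<open>Every heavy coefficient exceeds \<open>11 / 5 * \<beta>\<close>, so the term
    \<open>2 * (real (card H) * \<beta>)\<close> absorbs at most 10/11 of the heavy weight; the
    remaining 1/11 appears in the claim.\<close>
  have "(\<Sum>g\<in>H. 11 / 5 * \<beta>) \<le> (\<Sum>g\<in>H. l g)"
    unfolding \<beta>_def by (intro sum_mono) (auto simp: H)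
  then have "real (card H) * \<beta> \<le> 5 / 11 * (\<Sum>g\<in>H. l g)" by simp
  then show ?thesis using 1 by (simp add: algebra_simps)
qed

section \<open>Two targets without a common approximation\<close>

lemma swap_sheet_vimage:
  assumes "B \<in> sets borel"
  shows "{y. swap_sheet y \<in> B} \<in> sets borel"
    and "measure unif02 {y. swap_sheet y \<in> B} = measure unif02 B"
proof -
  show 1: "{y. swap_sheet y \<in> B} \<in> sets borel"
    using measurable_sets[OF swap_sheet_measurable, of B] assms by (simp add: vimage_def)
  have "measure unif02 B = measure (distr unif02 unif02 swap_sheet) B"
    by (simp add: distr_swap_sheet)
  also have "\<dots> = measure unif02 {y. swap_sheet y \<in> B}"
    using assms by (subst measure_distr) (auto simp: vimage_def)
  finally show "measure unif02 {y. swap_sheet y \<in> B} = measure unif02 B" ..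
qed

text \<open>Inverse elements appear when \<open>T g\<close> is moved from \<open>f\<close> to
  \<open>sg\<close> under the integral.\<close>

lemma sg_flat_neg:
  assumes S: "finite S" "S \<subseteq> Gset p"
  shows "(\<integral>y. (\<Sum>g\<in>S. m g * sg (T (neg g) y))\<^sup>2 \<partial>unif02) \<le> 33 / 20 * (\<Sum>g\<in>S. (m g)\<^sup>2)"
proof -
  have inj: "inj_on neg S"
    by (rule inj_on_inverseI[of _ neg]) (use S neg_neg in auto)
  have nn: "neg (neg g) = g" if "g \<in> S" for g using that S neg_neg by auto
  have "(\<integral>y. (\<Sum>g\<in>neg ` S. m (neg g) * sg (T g y))\<^sup>2 \<partial>unif02)
      \<le> 33 / 20 * (\<Sum>g\<in>neg ` S. (m (neg g))\<^sup>2)"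
    by (rule sg_flat) (use S Gset_neg in auto)
  then show ?thesis by (simp add: sum.reindex[OF inj] nn)
qed

lemma no_common_approximation:
  fixes f :: "real \<Rightarrow> real"
  assumes S: "finite S" "S \<subseteq> Gset p"
    and l1: "\<And>g. g \<in> S \<Longrightarrow> 0 \<le> l1 g" and l2: "\<And>g. g \<in> S \<Longrightarrow> 0 \<le> l2 g"
    and f: "integrable unif02 f" "AE y in unif02. 0 \<le> f y" "(\<integral>y. f y \<partial>unif02) = 1"
    and a1: "(\<integral>y. \<bar>1 + sg y - (\<Sum>g\<in>S. l1 g * f (T g y))\<bar> \<partial>unif02) \<le> 1 / 10 ^ 6"
    and a2: "(\<integral>y. \<bar>1 - sg y - (\<Sum>g\<in>S. l2 g * f (T g y))\<bar> \<partial>unif02) \<le> 1 / 10 ^ 6"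
  shows False
proof -
  let ?h = "\<lambda>l y. \<Sum>g\<in>S. l g * f (T g y)"
  let ?\<Psi> = "\<lambda>l y. \<Sum>g\<in>S. l g * sg (T (neg g) y)"
  define L where "L l = (\<Sum>g\<in>S. l g)" for l :: "(nat \<Rightarrow> int) \<Rightarrow> real"
  have SG: "g \<in> Gset p" "neg g \<in> Gset p" if "g \<in> S" for g
    using that S Gset_neg by auto
  have fm: "f \<in> borel_measurable borel"
    using borel_measurable_integrable[OF f(1)] by (simp add: borel_measurable_unif02)
  have hi: "integrable unif02 (?h l)" for l
    by (intro Bochner_Integration.integrable_sum integrable_mult_right integrable_T f SG)
  have sgi: "integrable unif02 (\<lambda>y. c + d * sg y)" for c d
    by (rule bounded_integrable[of _ "\<bar>c\<bar> + \<bar>d\<bar>"])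
       (auto intro!: order.trans[OF abs_triangle_ineq] simp: abs_mult)
  have int_h: "(\<integral>y. ?h l y \<partial>unif02) = L l" for l
    using integrable_T[OF SG(1) f(1)] integral_T[OF SG(1) fm] f(3)
    by (simp add: Bochner_Integration.integral_sum L_def)
  \<comment> \<open>Invariance of the integral moves each \<open>T g\<close> from \<open>f\<close>
    to \<open>sg\<close> as its inverse.\<close>
  have int_sg_h: "(\<integral>y. sg y * ?h l y \<partial>unif02) = (\<integral>y. f y * ?\<Psi> l y \<partial>unif02)" for l
  proof -
    have i1: "integrable unif02 (\<lambda>y. f y * sg (T (neg g) y))" if "g \<in> S" for g
      by (rule integrable_mult_bounded[OF f(1) sgT_measurable[OF SG(2)[OF that]], of 1]) simp
    have eq: "(\<integral>y. f (T g y) * sg y \<partial>unif02) = (\<integral>y. f y * sg (T (neg g) y) \<partial>unif02)"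
      and i2: "integrable unif02 (\<lambda>y. f (T g y) * sg y)" if "g \<in> S" for g
      using integral_T[OF SG(1)[OF that], of "\<lambda>y. f y * sg (T (neg g) y)"]
        borel_measurable_integrable[OF i1[OF that]] integrable_T[OF SG(1)[OF that] i1[OF that]]
      by (simp_all add: borel_measurable_unif02 T_neg SG(1)[OF that])
    have "(\<integral>y. sg y * ?h l y \<partial>unif02) = (\<integral>y. (\<Sum>g\<in>S. l g * (f (T g y) * sg y)) \<partial>unif02)"
      by (simp add: sum_distrib_left mult_ac)
    also have "\<dots> = (\<Sum>g\<in>S. l g * (\<integral>y. f y * sg (T (neg g) y) \<partial>unif02))"
      using i2 eq by (simp add: Bochner_Integration.integral_sum)
    also have "\<dots> = (\<integral>y. (\<Sum>g\<in>S. l g * (f y * sg (T (neg g) y))) \<partial>unif02)"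
      using i1 by (simp add: Bochner_Integration.integral_sum)
    also have "\<dots> = (\<integral>y. f y * ?\<Psi> l y \<partial>unif02)"
      by (simp add: sum_distrib_left mult_ac)
    finally show ?thesis .
  qed
  \<comment> \<open>Integrating the approximation error shows that the total weight is close to 1;
    testing it against \<open>sg\<close> shows that the integral of \<open>f\<close> times the
    adjoint sum is close to \<open>d\<close>.\<close>
  have est: "\<bar>1 - L l\<bar> \<le> 1 / 10 ^ 6" "\<bar>d - (\<integral>y. f y * ?\<Psi> l y \<partial>unif02)\<bar> \<le> 1 / 10 ^ 6"
    if a: "(\<integral>y. \<bar>1 + d * sg y - ?h l y\<bar> \<partial>unif02) \<le> 1 / 10 ^ 6" for l d
  proof -
    have i: "integrable unif02 (\<lambda>y. 1 + d * sg y - ?h l y)"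
      using sgi hi by (rule Bochner_Integration.integrable_diff)
    have "(\<integral>y. 1 + d * sg y - ?h l y \<partial>unif02) = 1 - L l"
    proof -
      have "(\<integral>y. 1 + d * sg y - ?h l y \<partial>unif02) = (\<integral>y. 1 + d * sg y \<partial>unif02) - L l"
        using Bochner_Integration.integral_diff[OF sgi[of 1 d] hi[of l]] by (simp add: int_h)
      also have "(\<integral>y. 1 + d * sg y \<partial>unif02) = 1"
        using sgi[of 0 1] unif02.prob_space by (simp add: integral_sg)
      finally show ?thesis .
    qed
    then show "\<bar>1 - L l\<bar> \<le> 1 / 10 ^ 6"
      using integral_abs_bound[of unif02 "\<lambda>y. 1 + d * sg y - ?h l y"] a by linarith
    have sh: "integrable unif02 (\<lambda>y. ?h l y * sg y)"
      by (rule integrable_mult_bounded[OF hi, of _ 1]) auto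
    have "(\<integral>y. sg y * (1 + d * sg y - ?h l y) \<partial>unif02) = (\<integral>y. (d + 1 * sg y) - ?h l y * sg y \<partial>unif02)"
    proof (intro Bochner_Integration.integral_cong refl)
      fix y
      have "sg y * (1 + d * sg y - ?h l y) = sg y + d * (sg y * sg y) - ?h l y * sg y"
        by (simp only: algebra_simps)
      then show "sg y * (1 + d * sg y - ?h l y) = (d + 1 * sg y) - ?h l y * sg y" by simp
    qed
    also have "\<dots> = (\<integral>y. d + 1 * sg y \<partial>unif02) - (\<integral>y. ?h l y * sg y \<partial>unif02)"
      by (rule Bochner_Integration.integral_diff[OF sgi sh])
    also have "(\<integral>y. d + 1 * sg y \<partial>unif02) = d"
      using sgi[of 0 1] unif02.prob_space by (simp add: integral_sg)
    also have "(\<integral>y. ?h l y * sg y \<partial>unif02) = (\<integral>y. f y * ?\<Psi> l y \<partial>unif02)"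
      using int_sg_h[of l] by (simp add: mult.commute)
    finally have "d - (\<integral>y. f y * ?\<Psi> l y \<partial>unif02) = (\<integral>y. sg y * (1 + d * sg y - ?h l y) \<partial>unif02)" ..
    moreover have "\<bar>\<integral>y. sg y * (1 + d * sg y - ?h l y) \<partial>unif02\<bar> \<le> (\<integral>y. \<bar>sg y * (1 + d * sg y - ?h l y)\<bar> \<partial>unif02)"
      by (rule integral_abs_bound)
    moreover have "(\<integral>y. \<bar>sg y * (1 + d * sg y - ?h l y)\<bar> \<partial>unif02) = (\<integral>y. \<bar>1 + d * sg y - ?h l y\<bar> \<partial>unif02)"
      by (simp add: abs_mult)
    ultimately show "\<bar>d - (\<integral>y. f y * ?\<Psi> l y \<partial>unif02)\<bar> \<le> 1 / 10 ^ 6"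
      using a by linarith
  qed
  note e1 = est[of 1 l1] and e2 = est[of "-1" l2]
  have e1: "\<bar>1 - L l1\<bar> \<le> 1 / 10 ^ 6" "\<bar>1 - (\<integral>y. f y * ?\<Psi> l1 y \<partial>unif02)\<bar> \<le> 1 / 10 ^ 6"
    using e1 a1 by simp_all
  have e2: "\<bar>1 - L l2\<bar> \<le> 1 / 10 ^ 6" "\<bar>- 1 - (\<integral>y. f y * ?\<Psi> l2 y \<partial>unif02)\<bar> \<le> 1 / 10 ^ 6"
    using e2 a2 by simp_all
  have \<Psi>m: "?\<Psi> l \<in> borel_measurable borel" for l
    using sgT_measurable[OF SG(2)] by (intro borel_measurable_sum borel_measurable_times) auto
  have \<Psi>b: "\<bar>?\<Psi> l y\<bar> \<le> (\<Sum>g\<in>S. \<bar>l g\<bar>)" for l y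
    by (rule order.trans[OF sum_abs]) (simp add: abs_mult)
  have L_abs: "(\<Sum>g\<in>S. \<bar>l1 g\<bar>) = L l1" "(\<Sum>g\<in>S. \<bar>l2 g\<bar>) = L l2"
    unfolding L_def using l1 l2 by (auto intro!: sum.cong)
  \<comment> \<open>\<open>D\<close> is the gap between the difference of the two adjoint sums and
    its upper bound \<open>L l1 + L l2\<close>. It is nonnegative with tiny integral against
    \<open>f\<close>, so \<open>f\<close> concentrates where \<open>D\<close> is small.\<close>
  define D where "D y = L l1 + L l2 - (?\<Psi> l1 y - ?\<Psi> l2 y)" for y
  have D0: "0 \<le> D y" for y
    using \<Psi>b[of l1 y] \<Psi>b[of l2 y] unfolding L_abs D_def by linarith
  have Dm: "D \<in> borel_measurable borel"
    unfolding D_def[abs_def] using \<Psi>m by measurable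
  have f\<Psi>: "integrable unif02 (\<lambda>y. f y * ?\<Psi> l y)" for l
    by (rule integrable_mult_bounded[OF f(1) \<Psi>m \<Psi>b])
  have fD_eq: "(\<lambda>y. f y * D y) = (\<lambda>y. (L l1 + L l2) * f y - (f y * ?\<Psi> l1 y - f y * ?\<Psi> l2 y))"
    by (simp add: D_def algebra_simps)
  have fDi: "integrable unif02 (\<lambda>y. f y * D y)"
    unfolding fD_eq using f(1) f\<Psi> by (intro Bochner_Integration.integrable_diff integrable_mult_right)
  have "(\<integral>y. f y * D y \<partial>unif02) = (L l1 + L l2) - ((\<integral>y. f y * ?\<Psi> l1 y \<partial>unif02) - (\<integral>y. f y * ?\<Psi> l2 y \<partial>unif02))"
    unfolding fD_eq using f(1,3) f\<Psi>[of l1] f\<Psi>[of l2] by simp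
  then have fD: "(\<integral>y. f y * D y \<partial>unif02) \<le> 4 / 10 ^ 6"
    using e1 e2 by linarith
  define B where "B = {y. D y \<le> 1 / 100}"
  have Bm: "B \<in> sets borel"
    unfolding B_def using Dm by measurable
  define \<beta> where "\<beta> = measure unif02 B"
  have fBi: "integrable unif02 (\<lambda>y. f y * indicator (- B) y)"
    using Bm by (intro integrable_mult_bounded[of _ _ 1] f) (auto simp: indicator_def)
  \<comment> \<open>Markov's inequality at the threshold 1/100 defining \<open>B\<close>.\<close>
  have off: "(\<integral>y. f y * indicator (- B) y \<partial>unif02) \<le> 4 / 10 ^ 4"
  proof -
    have "(\<integral>y. f y * indicator (- B) y \<partial>unif02) \<le> (\<integral>y. 100 * (f y * D y) \<partial>unif02)"
    proof (rule integral_mono_AE)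
      show "AE y in unif02. f y * indicator (- B) y \<le> 100 * (f y * D y)"
        using f(2)
      proof eventually_elim
        case (elim y)
        have "indicator (- B) y \<le> 100 * D y"
          using D0[of y] by (auto simp: B_def indicator_def)
        from mult_left_mono[OF this elim] show ?case by (simp add: mult_ac)
      qed
    qed (use fBi fDi in auto)
    then show ?thesis using fD fDi by simp
  qed
  define H1 where "H1 = {g \<in> S. 11 / 5 * measure unif02 B < l1 g}"
  define H2 where "H2 = {g \<in> S. 11 / 5 * measure unif02 B < l2 g}"
  have "(\<Sum>g\<in>H1. l1 g) * (1 / 11 - 4 / 10 ^ 4) \<le> 1 / 10 ^ 6"
    by (rule heavy_mass[OF S l1 f _ _ _ a1 Bm off H1_def]) (auto simp: sg_def)
  then have M1: "(\<Sum>g\<in>H1. l1 g) \<le> 1 / 100" by simp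
  have "(\<Sum>g\<in>H2. l2 g) * (1 / 11 - 4 / 10 ^ 4) \<le> 1 / 10 ^ 6"
    by (rule heavy_mass[OF S l2 f _ _ _ a2 Bm off H2_def]) (auto simp: sg_def)
  then have M2: "(\<Sum>g\<in>H2. l2 g) \<le> 1 / 100" by simp
  \<comment> \<open>Removing the heavy coefficients moves each adjoint sum by at most 1/100 and caps
    what remains at \<open>11 / 5 * \<beta>\<close>.\<close>
  define m1 where "m1 g = (if g \<in> H1 then 0 else l1 g)" for g
  define m2 where "m2 g = (if g \<in> H2 then 0 else l2 g)" for g
  define W where "W y = (\<Sum>g\<in>S. (m1 g - m2 g) * sg (T (neg g) y))" for y
  have cut: "\<bar>?\<Psi> l y - ?\<Psi> (\<lambda>g. if g \<in> H then 0 else l g) y\<bar> \<le> (\<Sum>g\<in>H. l g)"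
    if "H \<subseteq> S" "\<And>g. g \<in> S \<Longrightarrow> 0 \<le> l g" for l H y
  proof -
    have "?\<Psi> l y - ?\<Psi> (\<lambda>g. if g \<in> H then 0 else l g) y = (\<Sum>g\<in>S. if g \<in> H then l g * sg (T (neg g) y) else 0)"
      unfolding sum_subtractf[symmetric] by (intro sum.cong) auto
    also have "\<dots> = (\<Sum>g\<in>H. l g * sg (T (neg g) y))"
      using that(1) S(1) by (simp add: sum.inter_restrict[symmetric] Int_absorb1)
    finally show ?thesis
      using that sum_abs[of "\<lambda>g. l g * sg (T (neg g) y)" H] by (auto simp: abs_mult subset_iff)
  qed
  have W_eq: "W y = ?\<Psi> m1 y - ?\<Psi> m2 y" for y
    by (simp add: W_def left_diff_distrib sum_subtractf)
  \<comment> \<open>From about 2, the threshold in \<open>B\<close> costs 1/100 and the two removals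
    cost 1/100 each.\<close>
  have W_B: "196 / 100 \<le> W y" if "y \<in> B" for y
  proof -
    have "\<bar>?\<Psi> l1 y - ?\<Psi> m1 y\<bar> \<le> (\<Sum>g\<in>H1. l1 g)"
      unfolding m1_def by (rule cut) (auto simp: H1_def l1)
    moreover have "\<bar>?\<Psi> l2 y - ?\<Psi> m2 y\<bar> \<le> (\<Sum>g\<in>H2. l2 g)"
      unfolding m2_def by (rule cut) (auto simp: H2_def l2)
    moreover have "(1::real) / 10 ^ 6 \<le> 1 / 1000" by simp
    ultimately show ?thesis
      using that M1 M2 e1(1) e2(1) unfolding B_def D_def W_eq mem_Collect_eq by linarith
  qed
  have W_swap: "W (swap_sheet y) = - W y" for y
    by (simp add: W_def T_swap_sheet SG sum_negf)
  have Wm: "W \<in> borel_measurable borel"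
    unfolding W_eq[abs_def] using \<Psi>m by (intro borel_measurable_diff)
  have W2i: "integrable unif02 (\<lambda>y. (W y)\<^sup>2)"
  proof (rule bounded_integrable)
    show "(\<lambda>y. (W y)\<^sup>2) \<in> borel_measurable borel" using Wm by measurable
    have Wb: "\<bar>W y\<bar> \<le> (\<Sum>g\<in>S. \<bar>m1 g - m2 g\<bar>)" for y
      unfolding W_def by (rule order.trans[OF sum_abs]) (simp add: abs_mult)
    show "\<bar>(W y)\<^sup>2\<bar> \<le> (\<Sum>g\<in>S. \<bar>m1 g - m2 g\<bar>)\<^sup>2" for y
      using power_mono[OF Wb[of y], of 2] by simp
  qed
  let ?B' = "{y. swap_sheet y \<in> B}"
  note B' = swap_sheet_vimage[OF Bm]
  have ind: "integrable unif02 (indicat_real A)" if "A \<in> sets borel" for A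
    using that by (intro bounded_integrable[of _ 1]) (auto simp: indicator_def)
  \<comment> \<open>\<open>W\<close> is at least 1.96 on \<open>B\<close> and at most -1.96 on the
    mirror image, so the two sets are disjoint, and both have measure
    \<open>\<beta>\<close>.\<close>
  have "(196 / 100)\<^sup>2 * (2 * \<beta>) = (\<integral>y. (196 / 100)\<^sup>2 * (indicator B y + indicator ?B' y) \<partial>unif02)"
    using ind[OF Bm] ind[OF B'(1)] Bm B' by (simp add: \<beta>_def)
  also have "\<dots> \<le> (\<integral>y. (W y)\<^sup>2 \<partial>unif02)"
  proof (rule integral_mono[OF _ W2i])
    show "integrable unif02 (\<lambda>y. (196 / 100)\<^sup>2 * (indicator B y + indicator ?B' y) :: real)"
      using ind[OF Bm] ind[OF B'(1)] by simp
    fix y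
    have sq: "(196 / 100)\<^sup>2 \<le> w\<^sup>2" if "196 / 100 \<le> w" for w :: real
      using that by (intro power_mono) auto
    show "(196 / 100)\<^sup>2 * (indicator B y + indicator ?B' y) \<le> (W y)\<^sup>2"
      using W_B[of y] W_B[of "swap_sheet y"] sq[of "W y"] sq[of "- W y"]
      by (cases "y \<in> B"; cases "y \<in> ?B'") (auto simp: W_swap)
  qed
  also have "\<dots> \<le> 33 / 20 * (\<Sum>g\<in>S. (m1 g - m2 g)\<^sup>2)"
    unfolding W_def by (rule sg_flat_neg[OF S])
  also have "\<dots> \<le> 33 / 20 * (11 / 5 * \<beta> * (L l1 + L l2))"
  proof -
    have "(m1 g - m2 g)\<^sup>2 \<le> 11 / 5 * \<beta> * (l1 g + l2 g)" if g: "g \<in> S" for g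
    proof -
      have b: "0 \<le> \<beta>" by (simp add: \<beta>_def)
      have 1: "0 \<le> m1 g" "m1 g \<le> l1 g" "m1 g \<le> 11 / 5 * \<beta>"
        using l1[OF g] g b by (auto simp: m1_def H1_def \<beta>_def)
      have 2: "0 \<le> m2 g" "m2 g \<le> l2 g" "m2 g \<le> 11 / 5 * \<beta>"
        using l2[OF g] g b by (auto simp: m2_def H2_def \<beta>_def)
      have "(m1 g - m2 g)\<^sup>2 = m1 g * m1 g + m2 g * m2 g - 2 * (m1 g * m2 g)"
        by (simp add: power2_eq_square algebra_simps)
      also have "\<dots> \<le> m1 g * m1 g + m2 g * m2 g" using 1(1) 2(1) by simp
      also have "\<dots> \<le> 11 / 5 * \<beta> * l1 g + 11 / 5 * \<beta> * l2 g"
        using 1 2 b by (intro add_mono mult_mono) auto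
      finally show ?thesis by (simp add: distrib_left)
    qed
    then have "(\<Sum>g\<in>S. (m1 g - m2 g)\<^sup>2) \<le> (\<Sum>g\<in>S. 11 / 5 * \<beta> * (l1 g + l2 g))"
      by (rule sum_mono)
    also have "\<dots> = 11 / 5 * \<beta> * (L l1 + L l2)"
      by (simp add: L_def sum_distrib_left sum.distrib distrib_left)
    finally show ?thesis by simp
  qed
  also have "\<dots> \<le> 33 / 20 * (11 / 5 * \<beta> * (2 + 2 / 10 ^ 6))"
  proof -
    have "L l1 + L l2 \<le> 2 + 2 / 10 ^ 6" using e1(1) e2(1) by linarith
    then show ?thesis by (intro mult_left_mono) (auto simp: \<beta>_def)
  qed
  \<comment> \<open>The left factor is 2 * 1.96^2 = 7.6832, while the right one is barely above 1.65
    * 2.2 * 2 = 7.26.\<close>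
  finally have "\<beta> \<le> 0" by (simp add: power2_eq_square)
  then have "\<beta> = 0" by (simp add: \<beta>_def measure_le_0_iff)
  \<comment> \<open>With \<open>B\<close> null, all the mass 1 of \<open>f\<close> lies off
    \<open>B\<close>, contradicting \<open>off\<close>.\<close>
  then have "AE y in unif02. y \<notin> B"
    using Bm by (intro AE_not_in) (simp add: \<beta>_def null_sets_def unif02.emeasure_eq_measure)
  then have "(\<integral>y. f y * indicator (- B) y \<partial>unif02) = (\<integral>y. f y \<partial>unif02)"
    using fm Bm by (intro integral_cong_AE) (auto simp: indicator_def borel_measurable_unif02)
  then show False using off f(3) by simp
qed

text \<open>Reduction to \<open>no_common_approximation\<close>: coefficients belonging to a
  repeated group element are added up, and \<open>f\<close> is rescaled to integral 1.\<close>

lemma not_AT: "\<not> AT_property unif02 (Gset p) T"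
proof
  assume AT: "AT_property unif02 (Gset p) T"
  define F where "F j y = (if j = 0 then 1 + sg y else 1 - sg y)" for j :: nat and y
  have F: "integrable unif02 (F j)" "AE y in unif02. 0 \<le> F j y" for j
    unfolding F_def by (auto intro!: bounded_integrable[of _ 2] simp: sg_def)
  have F01: "F 0 = (\<lambda>y. 1 + sg y)" "F 1 = (\<lambda>y. 1 - sg y)"
    by (auto simp: F_def)
  define Q where "Q s gs lam f \<longleftrightarrow> (\<forall>k<s. gs k \<in> Gset p) \<and> (\<forall>j<2. \<forall>k<s. lam j k > 0) \<and>
       integrable unif02 f \<and> (AE x in unif02. f x \<ge> 0) \<and>
       (\<forall>j<2. integrable unif02 (\<lambda>x. \<bar>F j x - (\<Sum>k<s. lam j k * f (T (gs k) x))\<bar>) \<and>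
              (\<integral>x. \<bar>F j x - (\<Sum>k<s. lam j k * f (T (gs k) x))\<bar> \<partial>unif02) < 1 / 10 ^ 6)"
    for s :: nat and gs :: "nat \<Rightarrow> nat \<Rightarrow> int" and lam :: "nat \<Rightarrow> nat \<Rightarrow> real" and f :: "real \<Rightarrow> real"
  have "\<exists>s>0. \<exists>gs lam f. Q s gs lam f"
    using AT[unfolded AT_property_def, rule_format, of 2 F "1 / 10 ^ 6"] F unfolding Q_def by simp
  then obtain s gs lam f where Q: "Q s gs lam f" by blast
  have gs: "\<And>k. k < s \<Longrightarrow> gs k \<in> Gset p"
    and lam: "\<And>j k. j < 2 \<Longrightarrow> k < s \<Longrightarrow> 0 < lam j k"
    and f: "integrable unif02 f" "AE y in unif02. 0 \<le> f y"
    and ap: "\<And>j. j < 2 \<Longrightarrow> (\<integral>y. \<bar>F j y - (\<Sum>k<s. lam j k * f (T (gs k) y))\<bar> \<partial>unif02) < 1 / 10 ^ 6"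
    using Q unfolding Q_def by blast+
  define S where "S = gs ` {..<s}"
  define l where "l j g = (\<Sum>k | k \<in> {..<s} \<and> gs k = g. lam j k)" for j g
  have S: "finite S" "S \<subseteq> Gset p" using gs by (auto simp: S_def)
  have l: "0 \<le> l j g" if "j < 2" for j g
    unfolding l_def using lam[OF that] by (intro sum_nonneg) (auto intro: less_imp_le)
  have agg: "(\<Sum>k<s. lam j k * f (T (gs k) y)) = (\<Sum>g\<in>S. l j g * f (T g y))" for j y
  proof -
    have "(\<Sum>k<s. lam j k * f (T (gs k) y))
        = (\<Sum>g\<in>gs ` {..<s}. \<Sum>k | k \<in> {..<s} \<and> gs k = g. lam j k * f (T (gs k) y))"
      by (rule sum.image_gen) simp
    also have "\<dots> = (\<Sum>g\<in>S. l j g * f (T g y))"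
      unfolding S_def l_def sum_distrib_right by (intro sum.cong) auto
    finally show ?thesis .
  qed
  define a where "a = (\<integral>y. f y \<partial>unif02)"
  have a0: "0 \<le> a" unfolding a_def using f(2) by (rule integral_nonneg_AE)
  \<comment> \<open>If \<open>f\<close> had integral 0, so would every combination of its
    translates, yet \<open>F 0\<close> has integral 1.\<close>
  have "a \<noteq> 0"
  proof
    assume a: "a = 0"
    have hi: "integrable unif02 (\<lambda>y. \<Sum>g\<in>S. l 0 g * f (T g y))"
      using S by (intro Bochner_Integration.integrable_sum integrable_mult_right integrable_T f) auto
    have fm: "f \<in> borel_measurable borel"
      using borel_measurable_integrable[OF f(1)] by (simp add: borel_measurable_unif02)
    have "(\<integral>y. (\<Sum>g\<in>S. l 0 g * f (T g y)) \<partial>unif02) = (\<Sum>g\<in>S. l 0 g * a)"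
      unfolding a_def using S integrable_T[OF _ f(1)] integral_T[OF _ fm]
      by (subst Bochner_Integration.integral_sum) (auto intro!: sum.cong simp: subset_iff)
    moreover have "(\<integral>y. F 0 y \<partial>unif02) = 1"
      unfolding F01 using unif02.prob_space bounded_integrable[of sg 1] by (simp add: integral_sg)
    ultimately have "(\<integral>y. F 0 y - (\<Sum>g\<in>S. l 0 g * f (T g y)) \<partial>unif02) = 1"
      using F(1)[of 0] hi a by simp
    then show False
      using integral_abs_bound[of unif02 "\<lambda>y. F 0 y - (\<Sum>g\<in>S. l 0 g * f (T g y))"] ap[of 0]
      by (simp add: agg)
  qed
  have resc: "(\<Sum>g\<in>S. (l j g * a) * (f (T g y) / a)) = (\<Sum>g\<in>S. l j g * f (T g y))" for j y
    using \<open>a \<noteq> 0\<close> by simp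
  show False
  proof (rule no_common_approximation[OF S, of "\<lambda>g. l 0 g * a" "\<lambda>g. l 1 g * a" "\<lambda>y. f y / a"])
    show "AE y in unif02. 0 \<le> f y / a" using f(2) a0 by (auto elim!: eventually_mono)
    show "(\<integral>y. f y / a \<partial>unif02) = 1" using \<open>a \<noteq> 0\<close> by (simp add: a_def)
    show "(\<integral>y. \<bar>1 + sg y - (\<Sum>g\<in>S. (l 0 g * a) * (f (T g y) / a))\<bar> \<partial>unif02) \<le> 1 / 10 ^ 6"
      using ap[of 0] unfolding resc agg F01 by simp
    show "(\<integral>y. \<bar>1 - sg y - (\<Sum>g\<in>S. (l 1 g * a) * (f (T g y) / a))\<bar> \<partial>unif02) \<le> 1 / 10 ^ 6"
      using ap[of 1] unfolding resc agg F01 by simp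
  qed (use l a0 f(1) in auto)
qed

end

section \<open>Simple spectrum\<close>

lemma power2_mono_abs: "\<bar>a\<bar> \<le> b \<Longrightarrow> a\<^sup>2 \<le> b\<^sup>2" for a b :: real
  by (metis abs_ge_zero power2_abs power_mono)

text \<open>Taking values in \<open>ennreal\<close> makes the squared L2 norm meaningful without
  integrability conditions.\<close>

definition sqn :: "(real \<Rightarrow> real) \<Rightarrow> ennreal" where
  "sqn u = (\<integral>\<^sup>+y. ennreal ((u y)\<^sup>2) \<partial>unif02)"

text \<open>Replaces the triangle inequality for squared norms; its factor 2 is why later tolerances
  are quartered.\<close>

lemma sqn_add_le:
  assumes m: "a \<in> borel_measurable borel" "b \<in> borel_measurable borel"
    and le: "sqn a \<le> ennreal x" "sqn b \<le> ennreal z" "0 \<le> x" "0 \<le> z"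
  shows "sqn (\<lambda>y. a y + b y) \<le> ennreal (2 * (x + z))"
proof -
  have sq: "(s + t)\<^sup>2 \<le> 2 * s\<^sup>2 + 2 * t\<^sup>2" for s t :: real
    using zero_le_power2[of "s - t"] by (simp add: power2_eq_square algebra_simps)
  have "sqn (\<lambda>y. a y + b y) \<le> (\<integral>\<^sup>+y. 2 * ennreal ((a y)\<^sup>2) + 2 * ennreal ((b y)\<^sup>2) \<partial>unif02)"
    unfolding sqn_def
  proof (rule nn_integral_mono)
    fix y
    have "ennreal ((a y + b y)\<^sup>2) \<le> ennreal (2 * (a y)\<^sup>2 + 2 * (b y)\<^sup>2)"
      by (rule ennreal_leI[OF sq])
    then show "ennreal ((a y + b y)\<^sup>2) \<le> 2 * ennreal ((a y)\<^sup>2) + 2 * ennreal ((b y)\<^sup>2)"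
      by (simp add: ennreal_plus ennreal_mult)
  qed
  also have "\<dots> = 2 * sqn a + 2 * sqn b"
    unfolding sqn_def using m by (simp add: nn_integral_add nn_integral_cmult)
  also have "\<dots> \<le> 2 * ennreal x + 2 * ennreal z"
    by (intro add_mono mult_left_mono le) auto
  also have "\<dots> = ennreal (2 * (x + z))"
    using le by (simp add: ennreal_plus ennreal_mult distrib_left)
  finally show ?thesis .
qed

lemma sqn_scale:
  assumes "a \<in> borel_measurable borel"
  shows "sqn (\<lambda>y. c * a y) = ennreal (c\<^sup>2) * sqn a"
  unfolding sqn_def using assms by (simp add: power_mult_distrib ennreal_mult nn_integral_cmult)

lemma sqn_bound:
  assumes "\<And>y. \<bar>u y\<bar> \<le> C"
  shows "sqn u \<le> ennreal (C\<^sup>2)"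
proof -
  have "sqn u \<le> (\<integral>\<^sup>+y. ennreal (C\<^sup>2) \<partial>unif02)"
    unfolding sqn_def
    by (intro nn_integral_mono ennreal_leI power2_mono_abs assms)
  then show ?thesis
    using unif02.emeasure_space_1 by simp
qed

lemma sqn_cong_AE:
  assumes "AE y in unif02. a y = b y"
  shows "sqn a = sqn b"
  unfolding sqn_def using assms by (intro nn_integral_cong_AE) (auto elim!: eventually_mono)

context prime_seq
begin

lemma sqn_T:
  assumes "g \<in> Gset p" "u \<in> borel_measurable borel"
  shows "sqn (\<lambda>y. u (T g y)) = sqn u"
proof -
  have "sqn u = (\<integral>\<^sup>+y. ennreal ((u y)\<^sup>2) \<partial>distr unif02 unif02 (T g))"
    by (simp add: sqn_def distr_T assms)
  also have "\<dots> = sqn (\<lambda>y. u (T g y))"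
    unfolding sqn_def using assms T_measurable by (subst nn_integral_distr) auto
  finally show ?thesis ..
qed

lemma measurable_T_comp:
  assumes "g \<in> Gset p" "u \<in> borel_measurable borel"
  shows "(\<lambda>y. u (T g y)) \<in> borel_measurable borel"
  using measurable_compose[OF T_measurable_borel[OF assms(1)] assms(2)] .

section \<open>The cyclic vector\<close>

definition cyl :: "nat \<Rightarrow> real \<Rightarrow> real" where
  "cyl k y = (if \<forall>n<k. dig n y = 0 then 1 else 0)"

definition f0 :: "real \<Rightarrow> real" where
  "f0 y = (\<Sum>k. (1 / 2) ^ k * cyl k y)"

definition cyc :: "real \<Rightarrow> real" where
  "cyc y = f0 y + sg y"

lemma cyl_measurable [measurable]: "cyl k \<in> borel_measurable borel"
  unfolding cyl_def[abs_def] by measurable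

lemma f0_measurable [measurable]: "f0 \<in> borel_measurable borel"
  unfolding f0_def[abs_def] by measurable

lemma cyc_measurable [measurable]: "cyc \<in> borel_measurable borel"
  unfolding cyc_def[abs_def] by measurable

lemma cyl_bounds: "0 \<le> cyl k y" "cyl k y \<le> 1"
  by (auto simp: cyl_def)

lemma f0_summable: "summable (\<lambda>k. (1 / 2) ^ k * cyl k y)"
  by (rule summable_comparison_test'[of "\<lambda>k. (1 / 2) ^ k" 0])
     (use cyl_bounds in \<open>auto simp: abs_mult intro!: mult_left_le\<close>)

text \<open>The partial sum runs up to \<open>k = N\<close> inclusive, so the geometric tail sums to
  exactly (1/2)^N.\<close>

lemma f0_tail: "\<bar>f0 y - (\<Sum>k<Suc N. (1 / 2) ^ k * cyl k y)\<bar> \<le> (1 / 2) ^ N"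
proof -
  have eq: "f0 y - (\<Sum>k<Suc N. (1 / 2) ^ k * cyl k y) = (\<Sum>k. (1 / 2) ^ (k + Suc N) * cyl (k + Suc N) y)"
    unfolding f0_def by (subst suminf_split_initial_segment[OF f0_summable, of _ "Suc N"]) simp
  have s1: "summable (\<lambda>k. (1 / 2) ^ (k + Suc N) * cyl (k + Suc N) y)"
    using summable_ignore_initial_segment[OF f0_summable] .
  have s2: "(\<lambda>k. (1 / 2 :: real) ^ (k + Suc N)) sums (1 / 2) ^ N"
  proof -
    have "(\<lambda>k. (1 / 2 :: real) ^ Suc N * (1 / 2) ^ k) sums ((1 / 2) ^ Suc N * (1 / (1 - 1 / 2)))"
      by (intro sums_mult geometric_sums) simp
    then show ?thesis by (simp add: power_add mult_ac)
  qed
  have "(\<Sum>k. (1 / 2) ^ (k + Suc N) * cyl (k + Suc N) y) \<le> (\<Sum>k. (1 / 2 :: real) ^ (k + Suc N))"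
    by (intro suminf_le s1 sums_summable[OF s2]) (use cyl_bounds in \<open>auto intro!: mult_left_le\<close>)
  moreover have "0 \<le> (\<Sum>k. (1 / 2) ^ (k + Suc N) * cyl (k + Suc N) y)"
    by (intro suminf_nonneg s1) (simp add: cyl_bounds)
  ultimately show ?thesis
    unfolding eq using sums_unique[OF s2] by simp
qed

lemma cyc_bounded: "\<bar>cyc y\<bar> \<le> 3"
  using f0_tail[of y 0] cyl_bounds[of 0 y] by (auto simp: cyc_def sg_def)

section \<open>The closed cyclic subspace\<close>

text \<open>Real coefficients suffice because \<open>cyc\<close> is real; complex functions are
  treated through their real and imaginary parts in \<open>simple_spectrum\<close>.\<close>

definition cyc_span :: "(real \<Rightarrow> real) set" where
  "cyc_span = {v. \<exists>S c. finite S \<and> S \<subseteq> Gset p \<and> v = (\<lambda>y. \<Sum>g\<in>S. c g * cyc (T g y))}"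

definition cyc_closure :: "(real \<Rightarrow> real) set" where
  "cyc_closure = {u \<in> borel_measurable borel.
     \<forall>\<epsilon>>0. \<exists>v\<in>cyc_span. sqn (\<lambda>y. u y - v y) \<le> ennreal \<epsilon>}"

lemma cyc_span_I: "finite S \<Longrightarrow> S \<subseteq> Gset p \<Longrightarrow> (\<lambda>y. \<Sum>g\<in>S. c g * cyc (T g y)) \<in> cyc_span"
  unfolding cyc_span_def by blast

lemma cyc_span_measurable: "v \<in> cyc_span \<Longrightarrow> v \<in> borel_measurable borel"
  unfolding cyc_span_def using measurable_T_comp[OF _ cyc_measurable]
  by (auto intro!: borel_measurable_sum borel_measurable_times)

lemma cyc_span_add:
  assumes "v \<in> cyc_span" "w \<in> cyc_span"
  shows "(\<lambda>y. v y + w y) \<in> cyc_span"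
proof -
  obtain S c where S: "finite S" "S \<subseteq> Gset p" "v = (\<lambda>y. \<Sum>g\<in>S. c g * cyc (T g y))"
    using assms(1) by (auto simp: cyc_span_def)
  obtain R d where R: "finite R" "R \<subseteq> Gset p" "w = (\<lambda>y. \<Sum>g\<in>R. d g * cyc (T g y))"
    using assms(2) by (auto simp: cyc_span_def)
  let ?c = "\<lambda>g. if g \<in> S then c g else 0" and ?d = "\<lambda>g. if g \<in> R then d g else 0"
  have "v y = (\<Sum>g\<in>S \<union> R. ?c g * cyc (T g y))" for y
    unfolding S(3) using S(1) R(1) by (intro sum.mono_neutral_cong_left) auto
  moreover have "w y = (\<Sum>g\<in>S \<union> R. ?d g * cyc (T g y))" for y
    unfolding R(3) using S(1) R(1) by (intro sum.mono_neutral_cong_left) auto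
  ultimately have "(\<lambda>y. v y + w y) = (\<lambda>y. \<Sum>g\<in>S \<union> R. (?c g + ?d g) * cyc (T g y))"
    by (simp add: distrib_right sum.distrib)
  then show ?thesis
    using cyc_span_I[of "S \<union> R" "\<lambda>g. ?c g + ?d g"] S R by simp
qed

lemma cyc_span_scale:
  assumes "v \<in> cyc_span"
  shows "(\<lambda>y. a * v y) \<in> cyc_span"
proof -
  obtain S c where S: "finite S" "S \<subseteq> Gset p" "v = (\<lambda>y. \<Sum>g\<in>S. c g * cyc (T g y))"
    using assms by (auto simp: cyc_span_def)
  have "(\<lambda>y. a * v y) = (\<lambda>y. \<Sum>g\<in>S. (a * c g) * cyc (T g y))"
    unfolding S(3) by (simp add: sum_distrib_left mult_ac)
  then show ?thesis using cyc_span_I[OF S(1,2), of "\<lambda>g. a * c g"] by simp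
qed

lemma cyc_span_T:
  assumes "v \<in> cyc_span" and h: "h \<in> Gset p"
  shows "(\<lambda>y. v (T h y)) \<in> cyc_span"
proof -
  obtain S c where S: "finite S" "S \<subseteq> Gset p" "v = (\<lambda>y. \<Sum>g\<in>S. c g * cyc (T g y))"
    using assms by (auto simp: cyc_span_def)
  have inv: "Gadd p (Gadd p g h) (neg h) = g" if "g \<in> S" for g
  proof
    fix n
    have "Gadd p (Gadd p g h) (neg h) n = g n mod int (p n)"
      by (simp add: Gadd_def neg_def mod_simps)
    then show "Gadd p (Gadd p g h) (neg h) n = g n" using that S(2) by auto
  qed
  have inj: "inj_on (\<lambda>g. Gadd p g h) S"
    by (rule inj_on_inverseI[of _ "\<lambda>g. Gadd p g (neg h)"]) (rule inv)
  have "(\<lambda>y. v (T h y)) = (\<lambda>y. \<Sum>g\<in>S. c g * cyc (T (Gadd p g h) y))"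
    unfolding S(3) using S(2) h by (intro ext sum.cong refl) (auto simp: T_add)
  also have "\<dots> = (\<lambda>y. \<Sum>g\<in>(\<lambda>g. Gadd p g h) ` S. c (Gadd p g (neg h)) * cyc (T g y))"
    by (simp add: sum.reindex[OF inj] inv)
  also have "\<dots> \<in> cyc_span"
    using S h Gset_add by (intro cyc_span_I) auto
  finally show ?thesis .
qed

lemma cyc_closure_measurable: "u \<in> cyc_closure \<Longrightarrow> u \<in> borel_measurable borel"
  by (simp add: cyc_closure_def)

lemma cyc_closure_I:
  assumes "u \<in> borel_measurable borel" "\<And>\<epsilon>. \<epsilon> > 0 \<Longrightarrow> \<exists>v\<in>cyc_span. sqn (\<lambda>y. u y - v y) \<le> ennreal \<epsilon>"
  shows "u \<in> cyc_closure"
  using assms by (auto simp: cyc_closure_def)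

lemma cyc_closure_E:
  assumes "u \<in> cyc_closure" "\<epsilon> > 0"
  obtains v where "v \<in> cyc_span" "sqn (\<lambda>y. u y - v y) \<le> ennreal \<epsilon>"
  using assms by (auto simp: cyc_closure_def)

lemma cyc_span_subset_closure:
  assumes "v \<in> cyc_span"
  shows "v \<in> cyc_closure"
  using assms by (intro cyc_closure_I cyc_span_measurable bexI[of _ v]) (auto simp: sqn_def)

lemma cyc_closure_add:
  assumes u: "u \<in> cyc_closure" and w: "w \<in> cyc_closure"
  shows "(\<lambda>y. u y + w y) \<in> cyc_closure"
proof (rule cyc_closure_I)
  show "(\<lambda>y. u y + w y) \<in> borel_measurable borel"
    using u w by (intro borel_measurable_add cyc_closure_measurable)
  fix \<epsilon> :: real assume \<epsilon>: "\<epsilon> > 0"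
  obtain a where a: "a \<in> cyc_span" "sqn (\<lambda>y. u y - a y) \<le> ennreal (\<epsilon> / 4)"
    using cyc_closure_E[OF u, of "\<epsilon> / 4"] \<epsilon> by auto
  obtain b where b: "b \<in> cyc_span" "sqn (\<lambda>y. w y - b y) \<le> ennreal (\<epsilon> / 4)"
    using cyc_closure_E[OF w, of "\<epsilon> / 4"] \<epsilon> by auto
  have "sqn (\<lambda>y. (u y - a y) + (w y - b y)) \<le> ennreal (2 * (\<epsilon> / 4 + \<epsilon> / 4))"
    using u w a b \<epsilon> by (intro sqn_add_le borel_measurable_diff) (auto dest: cyc_closure_measurable cyc_span_measurable)
  then have "sqn (\<lambda>y. u y + w y - (a y + b y)) \<le> ennreal \<epsilon>"
    by (simp add: algebra_simps)
  then show "\<exists>v\<in>cyc_span. sqn (\<lambda>y. u y + w y - v y) \<le> ennreal \<epsilon>"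
    using cyc_span_add[OF a(1) b(1)] by (intro bexI[of _ "\<lambda>y. a y + b y"])
qed

lemma cyc_closure_scale:
  assumes u: "u \<in> cyc_closure"
  shows "(\<lambda>y. c * u y) \<in> cyc_closure"
proof (rule cyc_closure_I)
  show "(\<lambda>y. c * u y) \<in> borel_measurable borel"
    using u by (intro borel_measurable_times borel_measurable_const cyc_closure_measurable)
  fix \<epsilon> :: real assume \<epsilon>: "\<epsilon> > 0"
  have c: "0 < c\<^sup>2 + 1" using zero_le_power2[of c] by linarith
  obtain a where a: "a \<in> cyc_span" "sqn (\<lambda>y. u y - a y) \<le> ennreal (\<epsilon> / (c\<^sup>2 + 1))"
    using cyc_closure_E[OF u, of "\<epsilon> / (c\<^sup>2 + 1)"] \<epsilon> c by auto
  have "sqn (\<lambda>y. c * (u y - a y)) = ennreal (c\<^sup>2) * sqn (\<lambda>y. u y - a y)"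
    using u a by (intro sqn_scale borel_measurable_diff) (auto dest: cyc_closure_measurable cyc_span_measurable)
  also have "\<dots> \<le> ennreal (c\<^sup>2) * ennreal (\<epsilon> / (c\<^sup>2 + 1))"
    by (intro mult_left_mono a) auto
  also have "\<dots> = ennreal (c\<^sup>2 * (\<epsilon> / (c\<^sup>2 + 1)))"
    using \<epsilon> c by (intro ennreal_mult[symmetric]) auto
  also have "\<dots> \<le> ennreal \<epsilon>"
    using \<epsilon> c by (intro ennreal_leI) (simp add: field_simps)
  finally have "sqn (\<lambda>y. c * u y - c * a y) \<le> ennreal \<epsilon>"
    by (simp add: right_diff_distrib)
  then show "\<exists>v\<in>cyc_span. sqn (\<lambda>y. c * u y - v y) \<le> ennreal \<epsilon>"
    using cyc_span_scale[OF a(1)] by (intro bexI[of _ "\<lambda>y. c * a y"])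
qed

lemma cyc_closure_diff: "u \<in> cyc_closure \<Longrightarrow> w \<in> cyc_closure \<Longrightarrow> (\<lambda>y. u y - w y) \<in> cyc_closure"
  using cyc_closure_add[OF _ cyc_closure_scale[of w "-1"], of u] by simp

lemma cyc_closure_zero: "(\<lambda>_. 0) \<in> cyc_closure"
  using cyc_span_I[of "{}"] cyc_span_subset_closure by simp

lemma cyc_closure_sum: "finite I \<Longrightarrow> (\<And>i. i \<in> I \<Longrightarrow> u i \<in> cyc_closure) \<Longrightarrow> (\<lambda>y. \<Sum>i\<in>I. c i * u i y) \<in> cyc_closure"
proof (induction I rule: finite_induct)
  case (insert i I)
  then have "(\<lambda>y. c i * u i y + (\<Sum>i\<in>I. c i * u i y)) \<in> cyc_closure"
    by (intro cyc_closure_add cyc_closure_scale) auto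
  then show ?case using insert by simp
qed (simp add: cyc_closure_zero)

lemma cyc_closure_T:
  assumes u: "u \<in> cyc_closure" and h: "h \<in> Gset p"
  shows "(\<lambda>y. u (T h y)) \<in> cyc_closure"
proof (rule cyc_closure_I)
  show "(\<lambda>y. u (T h y)) \<in> borel_measurable borel"
    using u h by (intro measurable_T_comp cyc_closure_measurable)
  fix \<epsilon> :: real assume \<epsilon>: "\<epsilon> > 0"
  obtain a where a: "a \<in> cyc_span" "sqn (\<lambda>y. u y - a y) \<le> ennreal \<epsilon>"
    using cyc_closure_E[OF u \<epsilon>] .
  have "sqn (\<lambda>y. u (T h y) - a (T h y)) = sqn (\<lambda>y. u y - a y)"
    using u a by (intro sqn_T[OF h, of "\<lambda>y. u y - a y"] borel_measurable_diff)
      (auto dest: cyc_closure_measurable cyc_span_measurable)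
  then show "\<exists>v\<in>cyc_span. sqn (\<lambda>y. u (T h y) - v y) \<le> ennreal \<epsilon>"
    using cyc_span_T[OF a(1) h] a(2) by (intro bexI[of _ "\<lambda>y. a (T h y)"]) simp_all
qed

lemma cyc_closure_closed:
  assumes u: "u \<in> borel_measurable borel"
    and approx: "\<And>\<epsilon>. \<epsilon> > 0 \<Longrightarrow> \<exists>w\<in>cyc_closure. sqn (\<lambda>y. u y - w y) \<le> ennreal \<epsilon>"
  shows "u \<in> cyc_closure"
proof (rule cyc_closure_I[OF u])
  fix \<epsilon> :: real assume \<epsilon>: "\<epsilon> > 0"
  obtain w where w: "w \<in> cyc_closure" "sqn (\<lambda>y. u y - w y) \<le> ennreal (\<epsilon> / 4)"
    using approx[of "\<epsilon> / 4"] \<epsilon> by auto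
  obtain v where v: "v \<in> cyc_span" "sqn (\<lambda>y. w y - v y) \<le> ennreal (\<epsilon> / 4)"
    using cyc_closure_E[OF w(1), of "\<epsilon> / 4"] \<epsilon> by auto
  have "sqn (\<lambda>y. (u y - w y) + (w y - v y)) \<le> ennreal (2 * (\<epsilon> / 4 + \<epsilon> / 4))"
    using u w v \<epsilon> by (intro sqn_add_le borel_measurable_diff) (auto dest: cyc_closure_measurable cyc_span_measurable)
  then have "sqn (\<lambda>y. u y - v y) \<le> ennreal \<epsilon>" by simp
  then show "\<exists>v\<in>cyc_span. sqn (\<lambda>y. u y - v y) \<le> ennreal \<epsilon>" using v(1) by blast
qed

lemma cyc_closure_cong_AE:
  assumes "w \<in> cyc_closure" "u \<in> borel_measurable borel" "AE y in unif02. u y = w y"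
  shows "u \<in> cyc_closure"
proof (rule cyc_closure_closed[OF assms(2)])
  have "sqn (\<lambda>y. u y - w y) = sqn (\<lambda>_. 0)"
    using assms(3) by (intro sqn_cong_AE) (auto elim!: eventually_mono)
  then have "sqn (\<lambda>y. u y - w y) = 0" by (simp add: sqn_def)
  then show "\<exists>w\<in>cyc_closure. sqn (\<lambda>y. u y - w y) \<le> ennreal \<epsilon>" for \<epsilon>
    using assms(1) by (intro bexI[of _ w]) auto
qed

text \<open>Dominated convergence, applied to the squared differences, turns the pointwise limit
  into a norm limit.\<close>

lemma cyc_closure_dominated:
  assumes ui: "\<And>i. ui i \<in> cyc_closure" and u: "u \<in> borel_measurable borel"
    and lim: "\<And>y. (\<lambda>i. ui i y) \<longlonglongrightarrow> u y"
    and w: "w \<in> borel_measurable borel" "sqn w < \<infinity>" "\<And>i y. \<bar>u y - ui i y\<bar> \<le> \<bar>w y\<bar>"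
  shows "u \<in> cyc_closure"
proof (rule cyc_closure_closed[OF u])
  fix \<epsilon> :: real assume \<epsilon>: "\<epsilon> > 0"
  have uim: "ui i \<in> borel_measurable borel" for i
    using ui by (rule cyc_closure_measurable)
  have "(\<lambda>i. sqn (\<lambda>y. u y - ui i y)) \<longlonglongrightarrow> (\<integral>\<^sup>+y. 0 \<partial>unif02)"
    unfolding sqn_def
  proof (rule nn_integral_dominated_convergence[where w = "\<lambda>y. ennreal ((w y)\<^sup>2)"])
    show "(\<integral>\<^sup>+y. ennreal ((w y)\<^sup>2) \<partial>unif02) < \<infinity>"
      using w(2) by (simp add: sqn_def)
    show "AE y in unif02. ennreal ((u y - ui i y)\<^sup>2) \<le> ennreal ((w y)\<^sup>2)" for i
      using power2_mono_abs[OF w(3)] by (intro AE_I2 ennreal_leI) simp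
    have "(\<lambda>i. ennreal ((u y - ui i y)\<^sup>2)) \<longlonglongrightarrow> ennreal ((u y - u y)\<^sup>2)" for y
      using lim[of y] by (intro tendsto_ennrealI tendsto_intros)
    then show "AE y in unif02. (\<lambda>i. ennreal ((u y - ui i y)\<^sup>2)) \<longlonglongrightarrow> 0"
      by simp
  qed (use u uim w(1) in auto)
  then have "(\<lambda>i. sqn (\<lambda>y. u y - ui i y)) \<longlonglongrightarrow> 0" by simp
  then have "eventually (\<lambda>i. sqn (\<lambda>y. u y - ui i y) < ennreal \<epsilon>) sequentially"
    using \<epsilon> by (intro order_tendstoD(2)[of _ 0]) auto
  then obtain i where "sqn (\<lambda>y. u y - ui i y) < ennreal \<epsilon>"
    by (meson eventually_sequentially order_refl)
  then show "\<exists>w\<in>cyc_closure. sqn (\<lambda>y. u y - w y) \<le> ennreal \<epsilon>"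
    using ui by (intro bexI[of _ "ui i"]) auto
qed

section \<open>Averaging over blocks of digits\<close>

lemma dig_T_eq_0:
  assumes "g \<in> Gset p"
  shows "dig n (T g y) = 0 \<longleftrightarrow> int (p n) dvd dig n y + g n"
  by (simp add: dig_T[OF assms] mod_eq_0_iff_dvd)

lemma dvd_dig: "int (p n) dvd dig n y \<longleftrightarrow> dig n y = 0"
  using dig_mod[of n y] by (metis dvd_0_right mod_0_imp_dvd dvd_eq_mod_eq_0)

text \<open>Padding with trivial factors up to \<open>N\<close> yields the product shape that
  \<open>sum_GN_prod\<close> factorises.\<close>

lemma cyl_T:
  assumes "g \<in> Gset p" "k \<le> N"
  shows "cyl k (T g y) = (\<Prod>n<N. if n < k then (if int (p n) dvd dig n y + g n then 1 else 0) else 1)"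
proof -
  have "cyl k (T g y) = (\<Prod>n<k. if int (p n) dvd dig n y + g n then 1 else 0)"
    unfolding cyl_def dig_T_eq_0[OF assms(1)] by auto
  also have "\<dots> = (\<Prod>n<N. if n < k then (if int (p n) dvd dig n y + g n then 1 else 0) else 1)"
    using assms(2) by (intro prod.mono_neutral_cong_left) auto
  finally show ?thesis .
qed

lemma cyl_prod: "cyl k y = (\<Prod>n<k. if dig n y = 0 then 1 else 0)"
  unfolding cyl_def by auto

text \<open>The weights fix the first \<open>M\<close> digits and average over the digits \<open>M, \<dots>, N - 1\<close>.\<close>

definition wt :: "nat \<Rightarrow> nat \<Rightarrow> int \<Rightarrow> real" where
  "wt M n h = (if n < M then (if h = 0 then 1 else 0) else 1 / real (p n))"

definition avg_weight :: "nat \<Rightarrow> nat \<Rightarrow> (nat \<Rightarrow> int) \<Rightarrow> real" where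
  "avg_weight M N g = (\<Prod>n<N. wt M n (g n))"

lemma avg_weight_nonneg: "0 \<le> avg_weight M N g"
  unfolding avg_weight_def wt_def by (intro prod_nonneg) auto

lemma sum_wt: "(\<Sum>h\<in>{0..<int (p n)}. wt M n h) = 1"
  unfolding wt_def by (cases "n < M") auto

lemma sum_avg_weight: "(\<Sum>g\<in>GN N. avg_weight M N g) = 1"
  unfolding avg_weight_def sum_GN_prod[of "wt M"] by (simp add: sum_wt)

text \<open>The sum factorises: a fixed digit contributes 1, an averaged one 1/p_n, which is at most
  1/2.\<close>

lemma sum_avg_weight_sq:
  assumes "M \<le> N"
  shows "(\<Sum>g\<in>GN N. (avg_weight M N g)\<^sup>2) \<le> 2 ^ M * (1 / 2) ^ N"
proof -
  have 1: "(\<Sum>h\<in>{0..<int (p n)}. (wt M n h)\<^sup>2) \<le> (if n < M then 1 else 1 / 2)" for n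
  proof (cases "n < M")
    case True
    then have "(\<Sum>h\<in>{0..<int (p n)}. (wt M n h)\<^sup>2) = (\<Sum>h\<in>{0..<int (p n)}. if h = 0 then 1 else 0)"
      by (intro sum.cong) (auto simp: wt_def)
    then show ?thesis using True by simp
  next
    case False
    then have "(\<Sum>h\<in>{0..<int (p n)}. (wt M n h)\<^sup>2) = real (p n) * (1 / real (p n))\<^sup>2"
      by (simp add: wt_def)
    also have "\<dots> = 1 / real (p n)" by (simp add: power2_eq_square)
    also have "\<dots> \<le> 1 / 2"
      using p_gt_2[of n] by (intro divide_left_mono) auto
    finally show ?thesis using False by simp
  qed
  have "(\<Sum>g\<in>GN N. (avg_weight M N g)\<^sup>2) = (\<Prod>n<N. \<Sum>h\<in>{0..<int (p n)}. (wt M n h)\<^sup>2)"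
    unfolding avg_weight_def prod_power_distrib by (rule sum_GN_prod[of "\<lambda>n h. (wt M n h)\<^sup>2"])
  also have "\<dots> \<le> (\<Prod>n<N. if n < M then 1 else 1 / 2)"
    using 1 by (intro prod_mono conjI sum_nonneg) auto
  also have "\<dots> = 2 ^ M * (1 / 2) ^ N"
    using assms
  proof (induction rule: dec_induct)
    case base
    have "(\<Prod>n<M. if n < M then 1 else 1 / 2 :: real) = 1" by (rule prod.neutral) auto
    then show ?case by (simp add: power_mult_distrib[symmetric])
  qed simp
  finally show ?thesis .
qed

text \<open>For \<open>k\<close> at most \<open>N\<close>, the probability that independent uniform
  digits at the places from \<open>M\<close> to \<open>k - 1\<close> are all zero.\<close>

definition avg_coeff :: "nat \<Rightarrow> nat \<Rightarrow> nat \<Rightarrow> real" where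
  "avg_coeff M N k = (\<Prod>n<N. if n < k \<and> M \<le> n then 1 / real (p n) else 1)"

lemma avg_coeff_pos: "0 < avg_coeff M N k"
  unfolding avg_coeff_def by (intro prod_pos) auto

lemma avg_coeff_1: "k \<le> M \<Longrightarrow> avg_coeff M N k = 1"
  unfolding avg_coeff_def by (intro prod.neutral) auto

text \<open>Digit by digit: below \<open>M\<close> the condition survives, from \<open>M\<close> to
  \<open>k - 1\<close> averaging replaces it by its probability, and from \<open>k\<close> on the
  weights sum to 1.\<close>

lemma average_cyl:
  assumes "k \<le> N"
  shows "(\<Sum>g\<in>GN N. avg_weight M N g * cyl k (T g y)) = avg_coeff M N k * cyl (min M k) y"
proof -
  let ?d = "\<lambda>n x. if int (p n) dvd x then 1 else (0::real)"
  have "(\<Sum>g\<in>GN N. avg_weight M N g * cyl k (T g y))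
      = (\<Sum>g\<in>GN N. \<Prod>n<N. wt M n (g n) * (if n < k then ?d n (dig n y + g n) else 1))"
    unfolding avg_weight_def prod.distrib using assms by (intro sum.cong refl) (simp add: cyl_T GN_def)
  also have "\<dots> = (\<Prod>n<N. \<Sum>h\<in>{0..<int (p n)}. wt M n h * (if n < k then ?d n (dig n y + h) else 1))"
    by (rule sum_GN_prod[of "\<lambda>n h. wt M n h * (if n < k then ?d n (dig n y + h) else 1)"])
  also have "\<dots> = (\<Prod>n<N. (if n < k \<and> M \<le> n then 1 / real (p n) else 1)
      * (if n < min M k then (if dig n y = 0 then 1 else 0) else 1))"
  proof (intro prod.cong refl)
    fix n
    have d: "(\<Sum>h\<in>{0..<int (p n)}. wt M n h * ?d n (dig n y + h)) = wt M n ((- dig n y) mod int (p n))"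
      by (rule sum_delta_mod) simp
    have z: "(- dig n y) mod int (p n) = 0 \<longleftrightarrow> dig n y = 0"
      using dvd_dig[of n y] by (simp add: mod_eq_0_iff_dvd)
    show "(\<Sum>h\<in>{0..<int (p n)}. wt M n h * (if n < k then ?d n (dig n y + h) else 1))
      = (if n < k \<and> M \<le> n then 1 / real (p n) else 1)
      * (if n < min M k then (if dig n y = 0 then 1 else 0) else 1)"
      using d sum_wt[of M n] z by (auto simp: wt_def)
  qed
  also have "\<dots> = avg_coeff M N k * cyl (min M k) y"
  proof -
    have "cyl (min M k) y = (\<Prod>n<N. if n < min M k then (if dig n y = 0 then 1 else 0) else 1)"
      unfolding cyl_prod using assms by (intro prod.mono_neutral_cong_left) auto
    then show ?thesis by (simp add: avg_coeff_def prod.distrib)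
  qed
  finally show ?thesis .
qed

lemma sqn_average_sg:
  assumes "M \<le> N"
  shows "sqn (\<lambda>y. \<Sum>g\<in>GN N. avg_weight M N g * sg (T g y)) \<le> ennreal (33 / 20 * 2 ^ M * (1 / 2) ^ N)"
proof -
  have S: "GN N \<subseteq> Gset p" by (auto simp: GN_def)
  let ?u = "\<lambda>y. \<Sum>g\<in>GN N. avg_weight M N g * sg (T g y)"
  have um: "?u \<in> borel_measurable borel"
    using sgT_measurable S by (intro borel_measurable_sum borel_measurable_times) auto
  have "\<bar>?u y\<bar> \<le> (\<Sum>g\<in>GN N. avg_weight M N g)" for y
    by (rule order.trans[OF sum_abs]) (simp add: abs_mult avg_weight_nonneg)
  then have "\<bar>(?u y)\<^sup>2\<bar> \<le> 1" for y
    using sum_avg_weight[of M N] by (simp add: abs_square_le_1)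
  then have "integrable unif02 (\<lambda>y. (?u y)\<^sup>2)"
    using um by (intro bounded_integrable[of _ 1]) auto
  then have "sqn ?u = ennreal (\<integral>y. (?u y)\<^sup>2 \<partial>unif02)"
    unfolding sqn_def by (intro nn_integral_eq_integral) auto
  also have "\<dots> \<le> ennreal (33 / 20 * (\<Sum>g\<in>GN N. (avg_weight M N g)\<^sup>2))"
    using S by (intro ennreal_leI sg_flat) auto
  also have "\<dots> \<le> ennreal (33 / 20 * 2 ^ M * (1 / 2) ^ N)"
    using sum_avg_weight_sq[OF assms] by (intro ennreal_leI) simp
  finally show ?thesis .
qed

text \<open>Averaging \<open>cyc\<close> over the digits from \<open>M\<close> to
  \<open>N - 1\<close> leaves the cylinders below \<open>M\<close> unchanged, collapses those from
  \<open>M\<close> to \<open>N\<close> to multiples of \<open>cyl M\<close>, and makes the rest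
  small. The earlier cylinders are already available by strong induction and can be
  subtracted.\<close>

lemma cyl_in_cyc_closure: "cyl M \<in> cyc_closure"
proof (induction M rule: less_induct)
  case (less M)
  show ?case
  proof (rule cyc_closure_closed[OF cyl_measurable])
    fix \<epsilon> :: real assume \<epsilon>: "\<epsilon> > 0"
    \<comment> \<open>Here \<open>4 ^ M\<close> bounds the square of \<open>1 / b\<close>, the 2
      comes from \<open>sqn_add_le\<close>, and the two summands bound the averaged tail and the
      averaged sign.\<close>
    define C where "C = (4::real) ^ M * (2 * (1 + 33 / 20 * 2 ^ M))"
    have C: "C > 0" unfolding C_def by (intro mult_pos_pos add_pos_pos) auto
    have "(\<lambda>N. C * (1 / 2) ^ N) \<longlonglongrightarrow> C * 0"
      by (intro tendsto_intros LIMSEQ_power_zero) simp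
    then have "eventually (\<lambda>N. C * (1 / 2) ^ N < \<epsilon>) sequentially"
      using \<epsilon> by (intro order_tendstoD(2)) auto
    then have "eventually (\<lambda>N. C * (1 / 2) ^ N < \<epsilon> \<and> M \<le> N) sequentially"
      using eventually_ge_at_top[of M] by eventually_elim auto
    then obtain N where N: "C * (1 / 2) ^ N < \<epsilon>" "M \<le> N"
      by (auto simp: eventually_sequentially)
    define A where "A u y = (\<Sum>g\<in>GN N. avg_weight M N g * u (T g y))" for u :: "real \<Rightarrow> real" and y
    have S: "GN N \<subseteq> Gset p" by (auto simp: GN_def)
    define r where "r y = f0 y - (\<Sum>k<Suc N. (1 / 2) ^ k * cyl k y)" for y
    have rm: "r \<in> borel_measurable borel" unfolding r_def[abs_def] by measurable
    have rb: "\<bar>r y\<bar> \<le> (1 / 2) ^ N" for y unfolding r_def by (rule f0_tail)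
    define b where "b = (\<Sum>k\<in>{M..N}. (1 / 2) ^ k * avg_coeff M N k)"
    \<comment> \<open>The term \<open>k = M\<close> alone gives this bound. It does not depend on
      \<open>N\<close>, so dividing by \<open>b\<close> keeps the error small.\<close>
    have b: "(1 / 2) ^ M \<le> b"
    proof -
      have "(\<Sum>k\<in>{M}. (1 / 2) ^ k * avg_coeff M N k) \<le> b"
        unfolding b_def using N(2) avg_coeff_pos[THEN less_imp_le] by (intro sum_mono2) auto
      then show ?thesis by (simp add: avg_coeff_1)
    qed
    then have b0: "b > 0" by (rule less_le_trans[rotated]) simp
    have A_cyc: "A cyc y = (\<Sum>k<M. (1 / 2) ^ k * cyl k y) + b * cyl M y + A r y + A sg y" for y
    proof -
      have "cyc z = (\<Sum>k<Suc N. (1 / 2) ^ k * cyl k z) + r z + sg z" for z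
        by (simp add: cyc_def r_def)
      then have "A cyc y = (\<Sum>g\<in>GN N. avg_weight M N g * (\<Sum>k<Suc N. (1 / 2) ^ k * cyl k (T g y))) + A r y + A sg y"
        by (simp only: A_def distrib_left sum.distrib)
      also have "(\<Sum>g\<in>GN N. avg_weight M N g * (\<Sum>k<Suc N. (1 / 2) ^ k * cyl k (T g y)))
          = (\<Sum>k<Suc N. (1 / 2) ^ k * (\<Sum>g\<in>GN N. avg_weight M N g * cyl k (T g y)))"
        unfolding sum_distrib_left by (subst sum.swap) (simp only: mult.left_commute)
      also have "\<dots> = (\<Sum>k<Suc N. (1 / 2) ^ k * (avg_coeff M N k * cyl (min M k) y))"
        by (intro sum.cong refl) (simp add: average_cyl)
      also have "{..<Suc N} = {..<M} \<union> {M..N}" using N(2) by auto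
      also have "(\<Sum>k\<in>{..<M} \<union> {M..N}. (1 / 2) ^ k * (avg_coeff M N k * cyl (min M k) y))
          = (\<Sum>k<M. (1 / 2) ^ k * (avg_coeff M N k * cyl (min M k) y))
            + (\<Sum>k\<in>{M..N}. (1 / 2) ^ k * (avg_coeff M N k * cyl (min M k) y))"
        by (rule sum.union_disjoint) auto
      also have "(\<Sum>k<M. (1 / 2) ^ k * (avg_coeff M N k * cyl (min M k) y)) = (\<Sum>k<M. (1 / 2) ^ k * cyl k y)"
        by (intro sum.cong refl) (simp add: avg_coeff_1)
      also have "(\<Sum>k\<in>{M..N}. (1 / 2) ^ k * (avg_coeff M N k * cyl (min M k) y)) = b * cyl M y"
        unfolding b_def sum_distrib_right by (intro sum.cong refl) (simp add: min_def)
      finally show ?thesis .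
    qed
    have Ar: "sqn (A r) \<le> ennreal ((1 / 2) ^ N)"
    proof -
      have "\<bar>A r y\<bar> \<le> (1 / 2) ^ N" for y
      proof -
        have "\<bar>A r y\<bar> \<le> (\<Sum>g\<in>GN N. avg_weight M N g * (1 / 2) ^ N)"
          unfolding A_def using avg_weight_nonneg rb
          by (intro order.trans[OF sum_abs] sum_mono) (auto simp: abs_mult intro!: mult_left_mono)
        then show ?thesis by (simp add: sum_distrib_right[symmetric] sum_avg_weight)
      qed
      then have "sqn (A r) \<le> ennreal (((1 / 2) ^ N)\<^sup>2)" by (rule sqn_bound)
      also have "\<dots> \<le> ennreal ((1 / 2) ^ N)"
        by (intro ennreal_leI) (simp add: power2_eq_square mult_left_le_one_le power_le_one)
      finally show ?thesis .
    qed
    have Asg: "sqn (A sg) \<le> ennreal (33 / 20 * 2 ^ M * (1 / 2) ^ N)"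
      unfolding A_def[abs_def] by (rule sqn_average_sg[OF N(2)])
    have Am: "A u \<in> borel_measurable borel" if "u \<in> borel_measurable borel" for u
    proof -
      have "(\<lambda>y. u (T g y)) \<in> borel_measurable borel" if "g \<in> GN N" for g
        using measurable_T_comp[of g u] \<open>u \<in> _\<close> that S by blast
      then show ?thesis
        unfolding A_def[abs_def] by (intro borel_measurable_sum borel_measurable_times) auto
    qed
    define z where "z y = (1 / b) * (A cyc y - (\<Sum>k<M. (1 / 2) ^ k * cyl k y))" for y
    have "z \<in> cyc_closure"
      unfolding z_def[abs_def]
    proof (intro cyc_closure_scale cyc_closure_diff cyc_closure_sum)
      show "(\<lambda>y. A cyc y) \<in> cyc_closure" unfolding A_def using S by (intro cyc_span_subset_closure cyc_span_I) auto
    qed (use less in auto)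
    moreover have "sqn (\<lambda>y. cyl M y - z y) \<le> ennreal \<epsilon>"
    proof -
      have "(\<lambda>y. cyl M y - z y) = (\<lambda>y. (- 1 / b) * (A r y + A sg y))"
      proof
        fix y
        have "z y = cyl M y + (A r y + A sg y) / b"
          using b0 by (simp add: z_def A_cyc field_simps)
        then show "cyl M y - z y = (- 1 / b) * (A r y + A sg y)" by simp
      qed
      then have "sqn (\<lambda>y. cyl M y - z y) = ennreal ((- 1 / b)\<^sup>2) * sqn (\<lambda>y. A r y + A sg y)"
        using Am[OF rm] Am[OF sg_measurable] by (simp only: sqn_scale borel_measurable_add)
      also have "\<dots> \<le> ennreal ((- 1 / b)\<^sup>2) * ennreal (2 * ((1 / 2) ^ N + 33 / 20 * 2 ^ M * (1 / 2) ^ N))"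
        by (intro mult_left_mono sqn_add_le Ar Asg Am rm) auto
      also have "\<dots> = ennreal ((- 1 / b)\<^sup>2 * (2 * ((1 / 2) ^ N + 33 / 20 * 2 ^ M * (1 / 2) ^ N)))"
        by (rule ennreal_mult[symmetric]) auto
      also have "\<dots> \<le> ennreal (4 ^ M * (2 * ((1 / 2) ^ N + 33 / 20 * 2 ^ M * (1 / 2) ^ N)))"
      proof (intro ennreal_leI mult_right_mono)
        have "1 / b \<le> 2 ^ M"
          using b b0 by (simp add: field_simps power_divide)
        then have "(1 / b)\<^sup>2 \<le> (2 ^ M)\<^sup>2" using b0 by (intro power_mono) auto
        also have "(2 ^ M)\<^sup>2 = (4::real) ^ M" by (simp add: power2_eq_square power_mult_distrib[symmetric])
        finally show "(- 1 / b)\<^sup>2 \<le> 4 ^ M" by simp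
      qed auto
      also have "4 ^ M * (2 * ((1 / 2) ^ N + 33 / 20 * 2 ^ M * (1 / 2) ^ N)) = C * (1 / 2) ^ N"
        unfolding C_def by (simp add: algebra_simps)
      also have "ennreal \<dots> \<le> ennreal \<epsilon>" using N(1) by (intro ennreal_leI) simp
      finally show ?thesis .
    qed
    ultimately show "\<exists>w\<in>cyc_closure. sqn (\<lambda>y. cyl M y - w y) \<le> ennreal \<epsilon>" by blast
  qed
qed

section \<open>From cylinders to all of L2\<close>

lemma f0_in_cyc_closure: "f0 \<in> cyc_closure"
proof (rule cyc_closure_dominated[where ui = "\<lambda>N y. \<Sum>k<N. (1 / 2) ^ k * cyl k y" and w = "\<lambda>_. 2"])
  show "(\<lambda>y. \<Sum>k<N. (1 / 2) ^ k * cyl k y) \<in> cyc_closure" for N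
    by (intro cyc_closure_sum cyl_in_cyc_closure) auto
  show "(\<lambda>N. \<Sum>k<N. (1 / 2) ^ k * cyl k y) \<longlonglongrightarrow> f0 y" for y
    unfolding f0_def by (rule summable_LIMSEQ[OF f0_summable])
  show "sqn (\<lambda>_. 2) < \<infinity>"
    by (rule order.strict_trans1[OF sqn_bound[of _ 2]]) auto
  show "\<bar>f0 y - (\<Sum>k<N. (1 / 2) ^ k * cyl k y)\<bar> \<le> \<bar>2\<bar>" for N y
  proof (cases N)
    case 0
    then show ?thesis using f0_tail[of y 0] cyl_bounds[of 0 y] by simp
  next
    case (Suc M)
    then show ?thesis using f0_tail[of y M] power_le_one[of "1 / 2 :: real" M] by simp
  qed
qed auto

lemma sg_in_cyc_closure: "sg \<in> cyc_closure"
proof -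
  have "cyc = (\<lambda>y. \<Sum>g\<in>{\<lambda>_. 0}. 1 * cyc (T g y))"
    by (simp add: T_zero)
  then have "cyc \<in> cyc_span" using cyc_span_I[of "{\<lambda>_. 0}" "\<lambda>_. 1"] by simp
  from cyc_closure_diff[OF cyc_span_subset_closure[OF this] f0_in_cyc_closure] show ?thesis
    by (simp add: cyc_def)
qed

text \<open>With product weights \<open>sleg_inverse\<close> the sum over translates of
  \<open>sg\<close> factorises, and each factor becomes the indicator of digit 0. The leftover
  \<open>sleg (p n) (dig n y)\<close> is 1 there.\<close>

lemma sg_cyl_in_cyc_closure: "(\<lambda>y. sg y * cyl N y) \<in> cyc_closure"
proof -
  let ?c = "\<lambda>g. \<Prod>n<N. sleg_inverse (p n) (g n)"
  have "(\<lambda>y. \<Sum>g\<in>GN N. ?c g * sg (T g y)) \<in> cyc_closure"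
    by (intro cyc_closure_sum cyc_closure_T sg_in_cyc_closure finite_GN) (simp add: GN_def)
  moreover have "(\<Sum>g\<in>GN N. ?c g * sg (T g y)) = sg y * cyl N y" for y
  proof -
    have "(\<Sum>g\<in>GN N. ?c g * sg (T g y))
        = (\<Sum>g\<in>GN N. sg y * (\<Prod>n<N. sleg_inverse (p n) (g n) * sleg (p n) (dig n y + g n) * sleg (p n) (dig n y)))"
    proof (intro sum.cong refl)
      fix g assume "g \<in> GN N"
      then have "\<phi> g y = (\<Prod>n<N. sleg (p n) (dig n y + g n) * sleg (p n) (dig n y))"
        by (intro \<phi>_eq) (simp add: GN_def)
      then show "?c g * sg (T g y)
          = sg y * (\<Prod>n<N. sleg_inverse (p n) (g n) * sleg (p n) (dig n y + g n) * sleg (p n) (dig n y))"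
        by (simp only: sg_T prod.distrib mult_ac)
    qed
    also have "\<dots> = sg y * (\<Prod>n<N. \<Sum>h\<in>{0..<int (p n)}.
        sleg_inverse (p n) h * sleg (p n) (dig n y + h) * sleg (p n) (dig n y))"
      unfolding sum_distrib_left[symmetric]
      by (subst sum_GN_prod[of "\<lambda>n h. sleg_inverse (p n) h * sleg (p n) (dig n y + h) * sleg (p n) (dig n y)"]) simp
    also have "\<dots> = sg y * (\<Prod>n<N. if dig n y = 0 then 1 else 0)"
      by (intro arg_cong2[where f = "(*)"] prod.cong refl)
         (auto simp: sum_distrib_right[symmetric] sleg_inverse prime_p p_gt_2 dvd_dig)
    finally show ?thesis by (simp add: cyl_prod)
  qed
  ultimately show ?thesis by simp
qed

text \<open>The element \<open>g\<close> carries the first \<open>N\<close> digits of the cell to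
  zero, so the cell is the preimage under \<open>T g\<close> of the zero cylinder restricted to one
  sheet.\<close>

lemma cell_in_cyc_closure:
  assumes k: "0 \<le> k" "k < 2 * int (P N)"
  shows "indicat_real {y. \<lfloor>real (P N) * y\<rfloor> = k} \<in> cyc_closure"
proof -
  define z where "z = of_int k / real (P N)"
  have zk: "\<lfloor>real (P N) * z\<rfloor> = k" by (simp add: z_def)
  have "of_int k < (of_int (2 * int (P N)) :: real)" using k(2) by (simp only: of_int_less_iff)
  then have z: "0 \<le> z" "z < 2" using k by (simp_all add: z_def field_simps)
  define g where "g n = (if n < N then (- dig n z) mod int (p n) else 0)" for n
  have "{n. g n \<noteq> 0} \<subseteq> {..<N}" by (auto simp: g_def)
  then have "finite {n. g n \<noteq> 0}" by (rule finite_subset) simp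
  then have g: "g \<in> Gset p" by (simp add: Gset_def g_def)
  have dz: "int (p n) dvd dig n y + g n \<longleftrightarrow> dig n y = dig n z" if "n < N" for n y
  proof -
    have "int (p n) dvd dig n y + g n \<longleftrightarrow> (dig n y + g n) mod int (p n) = 0"
      by (simp add: dvd_eq_mod_eq_0)
    also have "(dig n y + g n) mod int (p n) = (dig n y - dig n z) mod int (p n)"
      using that by (simp add: g_def mod_simps)
    also have "\<dots> = 0 \<longleftrightarrow> dig n y mod int (p n) = dig n z mod int (p n)"
      unfolding mod_eq_dvd_iff mod_eq_0_iff_dvd ..
    finally show ?thesis by simp
  qed
  have eT: "cyl N (T g y) = (if \<forall>n<N. dig n y = dig n z then 1 else 0)" for y
    unfolding cyl_def dig_T_eq_0[OF g] using dz by simp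
  have \<phi>z: "\<phi> g y = \<phi> g z" if "\<forall>n<N. dig n y = dig n z" for y
    using \<phi>_eq[of N g y] \<phi>_eq[of N g z] that by (simp add: g_def)
  \<comment> \<open>The half sum with \<open>sg z * sg y\<close> selects the sheet of
    \<open>z\<close>. The cocycle is constant on the cylinder, so the factor
    \<open>\<phi> g z\<close> undoes the sign introduced by \<open>T g\<close>.\<close>
  let ?u = "\<lambda>y. (1 / 2) * cyl N (T g y) + (sg z * \<phi> g z / 2) * (sg (T g y) * cyl N (T g y))"
  have uY: "?u \<in> cyc_closure"
    by (intro cyc_closure_add cyc_closure_scale cyc_closure_T[OF cyl_in_cyc_closure g] cyc_closure_T[OF sg_cyl_in_cyc_closure g])
  have "AE y in unif02. indicat_real {y. \<lfloor>real (P N) * y\<rfloor> = k} y = ?u y"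
    using AE_unif02
  proof eventually_elim
    case (elim y)
    have fl: "\<lfloor>y\<rfloor> = \<lfloor>z\<rfloor> \<longleftrightarrow> sg y = sg z"
    proof -
      have "\<lfloor>y\<rfloor> = 0 \<or> \<lfloor>y\<rfloor> = 1" "\<lfloor>z\<rfloor> = 0 \<or> \<lfloor>z\<rfloor> = 1"
        using elim z by (auto simp: floor_eq_iff)
      then show ?thesis by (auto simp: sg_def)
    qed
    have cell: "\<lfloor>real (P N) * y\<rfloor> = k \<longleftrightarrow> sg y = sg z \<and> (\<forall>n<N. dig n y = dig n z)"
      unfolding zk[symmetric] floor_P_eq_iff fl ..
    show ?case
    proof (cases "\<forall>n<N. dig n y = dig n z")
      case True
      have "?u y = 1 / 2 + sg z * sg y / 2"
        using True \<phi>_values[of g z] by (auto simp: eT sg_T \<phi>z[OF True])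
      then show ?thesis
        using True sg_values[of y] sg_values[of z] cell by (auto simp: indicator_def)
    next
      case False
      then have "cyl N (T g y) = 0" unfolding eT by (rule if_not_P)
      moreover have "\<lfloor>real (P N) * y\<rfloor> \<noteq> k" using cell False by blast
      ultimately show ?thesis by simp
    qed
  qed
  from cyc_closure_cong_AE[OF uY _ this] show ?thesis by simp
qed

lemma emeasure_cell: "emeasure unif02 {y. \<lfloor>real (P N) * y\<rfloor> = k} \<le> ennreal (1 / real (P N))"
proof -
  have eq: "{y. \<lfloor>real (P N) * y\<rfloor> = k} = {of_int k / real (P N)..<(of_int k + 1) / real (P N)}"
    by (auto simp: floor_eq_iff field_simps)
  have "emeasure unif02 {y. \<lfloor>real (P N) * y\<rfloor> = k}
      \<le> emeasure lborel ({0..<2} \<inter> {y. \<lfloor>real (P N) * y\<rfloor> = k})"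
  proof (subst emeasure_unif02)
    show "{y. \<lfloor>real (P N) * y\<rfloor> = k} \<in> sets borel" by measurable
    have half: "x / 2 \<le> x" for x :: ennreal
    proof -
      have "x / 2 \<le> (x + x) / 2" by (intro divide_right_mono_ennreal) simp
      then show ?thesis by (simp flip: mult_2 add: ennreal_mult_divide_eq mult.commute[of 2])
    qed
    show "emeasure lborel ({0..<2} \<inter> {y. \<lfloor>real (P N) * y\<rfloor> = k}) / 2
        \<le> emeasure lborel ({0..<2} \<inter> {y. \<lfloor>real (P N) * y\<rfloor> = k})"
      by (rule half)
  qed
  also have "\<dots> \<le> emeasure lborel {of_int k / real (P N)..<(of_int k + 1) / real (P N)}"
    unfolding eq by (intro emeasure_mono) auto
  also have "\<dots> = ennreal (1 / real (P N))"
    by (subst emeasure_lborel_Ico) (auto simp: field_simps diff_divide_distrib[symmetric])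
  finally show ?thesis .
qed

text \<open>For \<alpha> in (0,2], the union of the cells numbered below that of \<alpha> differs
  from the half-line on [0,2) only inside the cell of \<alpha>, whose measure tends to 0.\<close>

lemma lessThan_in_cyc_closure: "indicat_real {..<\<alpha>} \<in> cyc_closure"
proof -
  consider "\<alpha> \<le> 0" | "2 < \<alpha>" | "0 < \<alpha>" "\<alpha> \<le> 2" by linarith
  then show ?thesis
  proof cases
    case 1
    have "AE y in unif02. indicat_real {..<\<alpha>} y = 0"
      using AE_unif02 by eventually_elim (use 1 in auto)
    then show ?thesis by (intro cyc_closure_cong_AE[OF cyc_closure_zero]) auto
  next
    case 2
    have "AE y in unif02. indicat_real {..<\<alpha>} y = cyl 0 y"
      using AE_unif02 by eventually_elim (use 2 in \<open>auto simp: cyl_def\<close>)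
    then show ?thesis by (intro cyc_closure_cong_AE[OF cyl_in_cyc_closure]) auto
  next
    case 3
    show ?thesis
    proof (rule cyc_closure_closed)
      fix \<epsilon> :: real assume \<epsilon>: "\<epsilon> > 0"
      obtain N where N: "1 / \<epsilon> < 2 ^ N"
        using real_arch_pow[of 2 "1 / \<epsilon>"] by auto
      have "2 ^ N \<le> real (P N)"
        using P_ge[of N] by (metis of_nat_le_iff of_nat_numeral of_nat_power)
      then have "1 / \<epsilon> < real (P N)" using N by linarith
      then have PN: "1 / real (P N) < \<epsilon>" using \<epsilon> by (simp add: field_simps)
      define K where "K = \<lfloor>real (P N) * \<alpha>\<rfloor>"
      have "real (P N) * \<alpha> \<le> of_int (2 * int (P N))" using 3 by simp
      then have K: "K \<le> 2 * int (P N)" unfolding K_def by linarith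
      let ?c = "\<lambda>k. indicat_real {y. \<lfloor>real (P N) * y\<rfloor> = k}"
      let ?w = "\<lambda>y. \<Sum>k\<in>{0..<K}. 1 * ?c k y"
      have "?w \<in> cyc_closure" using K by (intro cyc_closure_sum cell_in_cyc_closure) auto
      moreover have "sqn (\<lambda>y. indicat_real {..<\<alpha>} y - ?w y) \<le> ennreal \<epsilon>"
      proof -
        have "AE y in unif02. ennreal ((indicat_real {..<\<alpha>} y - ?w y)\<^sup>2) \<le> indicator {y. \<lfloor>real (P N) * y\<rfloor> = K} y"
          using AE_unif02
        proof eventually_elim
          case (elim y)
          have y0: "0 \<le> \<lfloor>real (P N) * y\<rfloor>" using elim by simp
          have w: "?w y = (if \<lfloor>real (P N) * y\<rfloor> < K then 1 else 0)"
          proof -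
            have "?w y = (\<Sum>k\<in>{0..<K}. if k = \<lfloor>real (P N) * y\<rfloor> then 1 else 0)"
              by (intro sum.cong) (auto simp: indicator_def)
            then show ?thesis using y0 by simp
          qed
          have mono: "y < \<alpha> \<Longrightarrow> \<lfloor>real (P N) * y\<rfloor> \<le> K" "\<alpha> \<le> y \<Longrightarrow> K \<le> \<lfloor>real (P N) * y\<rfloor>"
            unfolding K_def by (auto intro!: floor_mono mult_left_mono)
          show ?case
          proof (cases "\<lfloor>real (P N) * y\<rfloor> = K")
            case True
            then show ?thesis unfolding w by (auto simp: indicator_def)
          next
            case False
            then have "indicat_real {..<\<alpha>} y = (if \<lfloor>real (P N) * y\<rfloor> < K then 1 else 0)"
              using mono by (cases "y < \<alpha>") auto
            then show ?thesis unfolding w by simp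
          qed
        qed
        then have "sqn (\<lambda>y. indicat_real {..<\<alpha>} y - ?w y) \<le> (\<integral>\<^sup>+y. indicator {y. \<lfloor>real (P N) * y\<rfloor> = K} y \<partial>unif02)"
          unfolding sqn_def by (rule nn_integral_mono_AE)
        also have "\<dots> = emeasure unif02 {y. \<lfloor>real (P N) * y\<rfloor> = K}"
          by (intro nn_integral_indicator) simp
        also have "\<dots> \<le> ennreal (1 / real (P N))" by (rule emeasure_cell)
        also have "\<dots> \<le> ennreal \<epsilon>" using PN by (intro ennreal_leI) simp
        finally show ?thesis .
      qed
      ultimately show "\<exists>w\<in>cyc_closure. sqn (\<lambda>y. indicat_real {..<\<alpha>} y - w y) \<le> ennreal \<epsilon>"
        by (intro bexI[of _ ?w])
    qed auto
  qed
qed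

text \<open>Dynkin's theorem: half-lines form an intersection-stable generator, and the property
  passes to complements and, by domination, to countable disjoint unions.\<close>

lemma indicator_in_cyc_closure:
  assumes "A \<in> sets borel"
  shows "indicat_real A \<in> cyc_closure"
proof -
  have borel: "sets borel = sigma_sets UNIV (range (lessThan :: real \<Rightarrow> _))"
    unfolding borel_Iio by (rule sets_measure_of) auto
  have one: "(\<lambda>_. 1) \<in> cyc_closure" using cyl_in_cyc_closure[of 0] by (simp add: cyl_def[abs_def])
  have "Int_stable (range (lessThan :: real \<Rightarrow> _))"
  proof (rule Int_stableI_image)
    fix a b :: real
    show "\<exists>c\<in>UNIV. {..<a} \<inter> {..<b} = {..<c}"
      by (intro bexI[of _ "min a b"]) auto
  qed
  moreover have "range (lessThan :: real \<Rightarrow> _) \<subseteq> Pow UNIV" by simp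
  ultimately show ?thesis
    using assms[unfolded borel]
  proof (induction A rule: sigma_sets_induct_disjoint)
    case (basic A)
    then show ?case using lessThan_in_cyc_closure by auto
  next
    case empty
    then show ?case using cyc_closure_zero by (simp add: indicator_def[abs_def])
  next
    case (compl A)
    have "indicat_real (UNIV - A) = (\<lambda>y. 1 - indicat_real A y)"
      by (auto simp: indicator_def)
    then show ?case using cyc_closure_diff[OF one compl(2)] by simp
  next
    case (union A)
    have disj: "\<And>i j. i \<noteq> j \<Longrightarrow> A i \<inter> A j = {}"
      using union(1) by (auto simp: disjoint_family_on_def)
    have Am: "A i \<in> sets borel" for i using union(2) borel by auto
    show ?case
    proof (rule cyc_closure_dominated[where ui = "\<lambda>n y. \<Sum>i<n. 1 * indicat_real (A i) y" and w = "\<lambda>_. 1"])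
      show "(\<lambda>y. \<Sum>i<n. 1 * indicat_real (A i) y) \<in> cyc_closure" for n
        using union(3) by (intro cyc_closure_sum) auto
      show "indicat_real (\<Union> (range A)) \<in> borel_measurable borel" using Am by auto
      show "(\<lambda>n. \<Sum>i<n. 1 * indicat_real (A i) y) \<longlonglongrightarrow> indicat_real (\<Union> (range A)) y" for y
        using indicator_sums[of A y] disj unfolding sums_def by simp
      show "sqn (\<lambda>_. 1) < \<infinity>"
        by (rule order.strict_trans1[OF sqn_bound[of _ 1]]) auto
      show "\<bar>indicat_real (\<Union> (range A)) y - (\<Sum>i<n. 1 * indicat_real (A i) y)\<bar> \<le> \<bar>1\<bar>" for n y
      proof -
        have "disjoint_family_on A {..<n}" using union(1) by (auto simp: disjoint_family_on_def)
        then have "(\<Sum>i<n. 1 * indicat_real (A i) y) = indicat_real (\<Union>i<n. A i) y"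
          by (simp add: indicator_UN_disjoint)
        then show ?thesis by (auto simp: indicator_def)
      qed
    qed auto
  qed
qed

text \<open>Approximating simple functions bounded by \<open>2 * \<bar>u\<bar>\<close> stay within
  \<open>3 * \<bar>u\<bar>\<close> of \<open>u\<close>, a square integrable bound.\<close>

lemma L2_in_cyc_closure:
  assumes u: "u \<in> borel_measurable borel" "sqn u < \<infinity>"
  shows "u \<in> cyc_closure"
proof -
  obtain F where F: "\<And>i. simple_function borel (F i)" "\<And>y. (\<lambda>i. F i y) \<longlonglongrightarrow> u y"
    "\<And>i y. dist (F i y) 0 \<le> 2 * dist (u y) 0"
    using borel_measurable_implies_sequence_metric[OF u(1), of 0] by auto
  show ?thesis
  proof (rule cyc_closure_dominated[where ui = F and w = "\<lambda>y. 3 * u y"])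
    show "F i \<in> cyc_closure" for i
    proof -
      have fin: "finite (range (F i))" using simple_functionD(1)[OF F(1)[of i]] by simp
      have "(\<lambda>y. \<Sum>x\<in>range (F i). x * indicat_real (F i -` {x}) y) \<in> cyc_closure"
        using fin simple_functionD(2)[OF F(1)[of i]] by (intro cyc_closure_sum indicator_in_cyc_closure) simp_all
      moreover have "(\<Sum>x\<in>range (F i). x * indicat_real (F i -` {x}) y) = F i y" for y
      proof -
        have "(\<Sum>x\<in>range (F i). x * indicat_real (F i -` {x}) y) = (\<Sum>x\<in>range (F i). if x = F i y then x else 0)"
          by (intro sum.cong) (auto simp: indicator_def)
        then show ?thesis using fin by simp
      qed
      ultimately show ?thesis by simp
    qed
    show "sqn (\<lambda>y. 3 * u y) < \<infinity>"
      using u by (simp add: sqn_scale ennreal_mult_less_top)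
    show "\<bar>u y - F i y\<bar> \<le> \<bar>3 * u y\<bar>" for i y
      using F(3)[of i y] by (simp add: dist_real_def)
  qed (use u F in auto)
qed

lemma simple_spectrum: "koopman_simple_spectrum unif02 (Gset p) T"
  unfolding koopman_simple_spectrum_def
proof (intro exI[of _ "\<lambda>y. complex_of_real (cyc y)"] conjI allI impI)
  show "(\<lambda>y. complex_of_real (cyc y)) \<in> borel_measurable unif02" by measurable
  show "integrable unif02 (\<lambda>y. (cmod (complex_of_real (cyc y)))\<^sup>2)"
    using power2_mono_abs[OF cyc_bounded] by (intro bounded_integrable[of _ "3\<^sup>2"]) auto
next
  fix h :: "real \<Rightarrow> complex" and \<epsilon> :: real
  assume h: "h \<in> borel_measurable unif02 \<and> integrable unif02 (\<lambda>x. (cmod (h x))\<^sup>2)" and \<epsilon>: "0 < \<epsilon>"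
  have hm: "h \<in> borel_measurable borel"
    using h by (simp only: measurable_cong_sets[OF sets_unif02 refl])
  have hfin: "(\<integral>\<^sup>+x. ennreal ((cmod (h x))\<^sup>2) \<partial>unif02) < \<infinity>"
    using h by (simp add: nn_integral_eq_integral)
  have "sqn (\<lambda>y. Re (h y)) < \<infinity>" "sqn (\<lambda>y. Im (h y)) < \<infinity>"
    unfolding sqn_def
    by (rule order.strict_trans1[OF nn_integral_mono hfin], simp add: cmod_power2 ennreal_leI)+
  then have ReIm: "(\<lambda>y. Re (h y)) \<in> cyc_closure" "(\<lambda>y. Im (h y)) \<in> cyc_closure"
    using hm by (auto intro!: L2_in_cyc_closure)
  obtain v where v: "v \<in> cyc_span" "sqn (\<lambda>y. Re (h y) - v y) \<le> ennreal (\<epsilon> / 4)"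
    using cyc_closure_E[OF ReIm(1), of "\<epsilon> / 4"] \<epsilon> by auto
  obtain w where w: "w \<in> cyc_span" "sqn (\<lambda>y. Im (h y) - w y) \<le> ennreal (\<epsilon> / 4)"
    using cyc_closure_E[OF ReIm(2), of "\<epsilon> / 4"] \<epsilon> by auto
  obtain S c where S: "finite S" "S \<subseteq> Gset p" "v = (\<lambda>y. \<Sum>g\<in>S. c g * cyc (T g y))"
    using v(1) by (auto simp: cyc_span_def)
  obtain R d where R: "finite R" "R \<subseteq> Gset p" "w = (\<lambda>y. \<Sum>g\<in>R. d g * cyc (T g y))"
    using w(1) by (auto simp: cyc_span_def)
  \<comment> \<open>The two real combinations merge into one complex combination over the union of
    their supports; its squared error is the sum of the two.\<close>
  define k where "k g = Complex (if g \<in> S then c g else 0) (if g \<in> R then d g else 0)" for g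
  let ?D = "\<lambda>y. h y - (\<Sum>g\<in>S \<union> R. k g * complex_of_real (cyc (T g y)))"
  have "v y = (\<Sum>g\<in>S \<union> R. Re (k g * complex_of_real (cyc (T g y))))" for y
    unfolding S(3) k_def using S(1) R(1) by (intro sum.mono_neutral_cong_left) auto
  moreover have "w y = (\<Sum>g\<in>S \<union> R. Im (k g * complex_of_real (cyc (T g y))))" for y
    unfolding R(3) k_def using S(1) R(1) by (intro sum.mono_neutral_cong_left) auto
  ultimately have D: "(cmod (?D y))\<^sup>2 = (Re (h y) - v y)\<^sup>2 + (Im (h y) - w y)\<^sup>2" for y
    by (simp only: cmod_power2 minus_complex.simps Re_sum Im_sum)
  have vm: "v \<in> borel_measurable borel" "w \<in> borel_measurable borel"
    using v w by (auto dest: cyc_span_measurable)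
  have "(\<integral>\<^sup>+y. ennreal ((cmod (?D y))\<^sup>2) \<partial>unif02) = sqn (\<lambda>y. Re (h y) - v y) + sqn (\<lambda>y. Im (h y) - w y)"
    unfolding D sqn_def using hm vm by (simp add: ennreal_plus nn_integral_add)
  also have "\<dots> \<le> ennreal (\<epsilon> / 4) + ennreal (\<epsilon> / 4)"
    by (intro add_mono v w)
  also have "\<dots> = ennreal (\<epsilon> / 2)" using \<epsilon> by (simp flip: ennreal_plus)
  finally have le: "(\<integral>\<^sup>+y. ennreal ((cmod (?D y))\<^sup>2) \<partial>unif02) \<le> ennreal (\<epsilon> / 2)" .
  have int: "integrable unif02 (\<lambda>y. (cmod (?D y))\<^sup>2)"
  proof (rule integrableI_nonneg)
    show "(\<lambda>y. (cmod (?D y))\<^sup>2) \<in> borel_measurable unif02"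
      unfolding D using hm vm by measurable
    show "(\<integral>\<^sup>+y. ennreal ((cmod (?D y))\<^sup>2) \<partial>unif02) < \<infinity>"
      using le by (rule order.strict_trans1) simp
  qed auto
  have "ennreal (\<integral>y. (cmod (?D y))\<^sup>2 \<partial>unif02) \<le> ennreal (\<epsilon> / 2)"
    using le by (simp add: nn_integral_eq_integral[OF int])
  then have "(\<integral>y. (cmod (?D y))\<^sup>2 \<partial>unif02) \<le> \<epsilon> / 2"
    using \<epsilon> by (subst (asm) ennreal_le_iff) auto
  then have "(\<integral>y. (cmod (?D y))\<^sup>2 \<partial>unif02) < \<epsilon>" using \<epsilon> by linarith
  then show "\<exists>S c. finite S \<and> S \<subseteq> Gset p \<and>
      integrable unif02 (\<lambda>x. (cmod (h x - (\<Sum>g\<in>S. c g * complex_of_real (cyc (T g x)))))\<^sup>2) \<and>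
      (\<integral>x. (cmod (h x - (\<Sum>g\<in>S. c g * complex_of_real (cyc (T g x)))))\<^sup>2 \<partial>unif02) < \<epsilon>"
    using int S R by (intro exI[of _ "S \<union> R"] exI[of _ k]) auto
qed

end

theorem theorem1p1:
  fixes p :: "nat \<Rightarrow> nat"
  assumes "strict_mono p"
    and "\<forall>n. prime (p n)"
    and "\<forall>n. p n \<ge> 5 ^ (2 * (n + 1))"
  shows "\<exists>(\<mu> :: real measure) (T :: (nat \<Rightarrow> int) \<Rightarrow> real \<Rightarrow> real).
           prob_space \<mu> \<and> sets \<mu> = sets borel \<and>
           measure_preserving_action \<mu> (Gset p) (Gadd p) (\<lambda>_. 0) T \<and>
           koopman_simple_spectrum \<mu> (Gset p) T \<and>
           \<not> AT_property \<mu> (Gset p) T"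
proof -
  interpret prime_seq p
    using assms by unfold_locales auto
  have "measure_preserving_action unif02 (Gset p) (Gadd p) (\<lambda>_. 0) T"
    unfolding measure_preserving_action_def
    using T_measurable distr_T T_add T_zero by auto
  then show ?thesis
    using prob_space_unif02 sets_unif02 simple_spectrum not_AT by blast
qed

end
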